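(* Let $\kappa$ be an uncountable regular cardinal with $\kappa^{<\kappa}=\kappa$. Let $\mathbb{P}$ be any forcing whose conditions are pseudo-$\kappa$-Laver trees (i.e. $\mathbb{P}\subseteq\mathbb{PL}_\kappa$, ordered by inclusion) and which is closed under the following operation: if $T\in\mathbb{P}$ and $\sigma\in T$ then $T\uparrow\sigma\in\mathbb{P}$. Then $\mathbb{P}$ adds a Cohen $\kappa$-real.
   Context: A tree is a subset of $\kappa^{<\kappa}$ closed under initial segments. A tree $T$ is limit-closed if for every limit $\lambda<\kappa$ and every $\subseteq$-increasing sequence $\langle\sigma_\alpha:\alpha<\lambda\rangle$ from $T$, $\bigcup_{\alpha<\lambda}\sigma_\alpha\in T$. For a tree $T$ and $\sigma\in T$, $T\restriction^\omega\sigma=\{\tau\in\kappa^{<\omega}:\sigma^\frown\tau\in T\}$. A short $\kappa$-Laver tree is a tree $L\subseteq\kappa^{<\omega}$ such that every $\sigma\in L$ extending $\mathrm{stem}(L)$ has $\kappa$ many immediate successors in $L$. A pseudo-$\kappa$-Laver tree is a limit-closed tree $T\subseteq\kappa^{<\kappa}$ such that every $\sigma\in T$ has an extension $\tau\in T$ for which $T\restriction^\omega\tau$ is a short $\kappa$-Laver tree; $\mathbb{PL}_\kappa$ is the set of these ordered by inclusion. $T\uparrow\sigma=\{\tau\in T:\sigma\subseteq\tau\lor\tau\subseteq\sigma\}$. A Cohen $\kappa$-real over $V$ is an element of $2^\kappa$ generic over $V$ for $\kappa$-Cohen forcing ($2^{<\kappa}$ ordered by end-extension); "$\mathbb{P}$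 adds a Cohen $\kappa$-real" means every $\mathbb{P}$-generic extension contains one. *)

theory Defs
  imports Main "HOL-Library.Sublist"
begin

unbundle cardinal_syntax

section \<open>The cardinal and sequences\<close>

text \<open>
  A cardinal \<open>\<kappa>\<close> is presented as a type \<open>'k\<close> of class \<open>wellorder\<close> whose order relation is a
  cardinal order; the elements of \<open>'k\<close> are the ordinals below \<open>\<kappa>\<close>, and \<open>{..<a}\<close> is the ordinal \<open>a\<close>.
\<close>

definition kappa :: "'k::wellorder rel" where
  "kappa = {(a, b). a \<le> b}"

text \<open>
  The set of all sequences of length below \<open>\<kappa>\<close> with values in \<open>'a\<close>: it is \<open>\<kappa>\<^sup><\<^sup>\<kappa>\<close> for \<open>'a = 'k\<close> and
  \<open>2\<^sup><\<^sup>\<kappa>\<close> for \<open>'a = bool\<close>. Inclusion of sequences is \<open>(\<subseteq>\<^sub>m)\<close>.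
\<close>

definition kseqs :: "('k::wellorder \<rightharpoonup> 'a) set" where
  "kseqs = {\<sigma>. \<exists>a. dom \<sigma> = {..<a}}"

definition seq_len :: "('k::wellorder \<rightharpoonup> 'a) \<Rightarrow> 'k" where
  "seq_len \<sigma> = (LEAST a. a \<notin> dom \<sigma>)"

text \<open>
  Elements of \<open>\<kappa>\<^sup><\<^sup>\<omega>\<close> are lists. The concatenation of \<open>\<sigma>\<close> with a finite sequence is used only
  when \<open>\<kappa>\<close> is infinite, so that it again has length below \<open>\<kappa>\<close>.
\<close>

primrec seq_append :: "('k::wellorder \<rightharpoonup> 'a) \<Rightarrow> 'a list \<Rightarrow> ('k \<rightharpoonup> 'a)" where
  "seq_append \<sigma> [] = \<sigma>"
| "seq_append \<sigma> (x # xs) = seq_append (\<sigma>(seq_len \<sigma> \<mapsto> x)) xs"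

section \<open>Trees\<close>

definition is_tree :: "('k::wellorder \<rightharpoonup> 'k) set \<Rightarrow> bool" where
  "is_tree T \<longleftrightarrow> T \<subseteq> kseqs \<and> (\<forall>\<sigma>\<in>T. \<forall>\<tau>\<in>kseqs. \<tau> \<subseteq>\<^sub>m \<sigma> \<longrightarrow> \<tau> \<in> T)"

definition is_limit :: "'k::wellorder \<Rightarrow> bool" where
  "is_limit l \<longleftrightarrow> (\<exists>a. a < l) \<and> (\<forall>a<l. \<exists>b<l. a < b)"

definition limit_closed :: "('k::wellorder \<rightharpoonup> 'k) set \<Rightarrow> bool" where
  "limit_closed T \<longleftrightarrow>
    (\<forall>l (s :: 'k \<Rightarrow> ('k \<rightharpoonup> 'k)).
       is_limit l \<and> (\<forall>a<l. s a \<in> T) \<and> (\<forall>b<l. \<forall>a<b. s a \<subseteq>\<^sub>m s b) \<longrightarrow>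
       (\<exists>\<tau>\<in>T. Map.graph \<tau> = (\<Union>a\<in>{..<l}. Map.graph (s a))))"

definition tree_restrict :: "('k::wellorder \<rightharpoonup> 'k) set \<Rightarrow> ('k \<rightharpoonup> 'k) \<Rightarrow> 'k list set" where
  "tree_restrict T \<sigma> = {\<tau>. seq_append \<sigma> \<tau> \<in> T}"

definition tree_up :: "('k::wellorder \<rightharpoonup> 'k) set \<Rightarrow> ('k \<rightharpoonup> 'k) \<Rightarrow> ('k \<rightharpoonup> 'k) set" where
  "tree_up T \<sigma> = {\<tau>\<in>T. \<sigma> \<subseteq>\<^sub>m \<tau> \<or> \<tau> \<subseteq>\<^sub>m \<sigma>}"

text \<open>
  The stem is the longest node comparable with every node. It need not exist (for instance when the
  tree is a single infinite branch); a Laver tree is required to have one, and hence is nonempty.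
\<close>

definition is_stem :: "'a list set \<Rightarrow> 'a list \<Rightarrow> bool" where
  "is_stem L s \<longleftrightarrow> s \<in> L \<and> (\<forall>t\<in>L. prefix s t \<or> prefix t s) \<and>
     (\<forall>s'\<in>L. (\<forall>t\<in>L. prefix s' t \<or> prefix t s') \<longrightarrow> prefix s' s)"

definition short_laver_tree :: "'k::wellorder list set \<Rightarrow> bool" where
  "short_laver_tree L \<longleftrightarrow>
     (\<forall>\<sigma>\<in>L. \<forall>\<tau>. prefix \<tau> \<sigma> \<longrightarrow> \<tau> \<in> L) \<and>
     (\<exists>s. is_stem L s \<and> (\<forall>\<sigma>\<in>L. prefix s \<sigma> \<longrightarrow> |{x. \<sigma> @ [x] \<in> L}| =o (kappa :: 'k rel)))"

text \<open>
  The empty set would satisfy the remaining clauses vacuously; as a forcing condition a tree is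
  nonempty.
\<close>

definition PL :: "('k::wellorder \<rightharpoonup> 'k) set set" where
  "PL = {T. T \<noteq> {} \<and> is_tree T \<and> limit_closed T \<and>
     (\<forall>\<sigma>\<in>T. \<exists>\<tau>\<in>T. \<sigma> \<subseteq>\<^sub>m \<tau> \<and> short_laver_tree (tree_restrict T \<tau>))}"

section \<open>Names and the forcing relation\<close>

text \<open>
  The role of the ground model is played by the universe of the logic. A forcing is a set \<open>P\<close>
  of elements of an ordered type, smaller elements being stronger. A name is a set of pairs
  (name, condition); to have a type of names, the cardinality of these sets is bounded
  hereditarily by the cardinality of an index type \<open>'i\<close>, which is a parameter: a name is the range
  of a partial family indexed by \<open>'i\<close>.
\<close>

datatype ('i, 'p) name = Name "'i \<rightharpoonup> ('i, 'p) name \<times> 'p"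

primrec pairs :: "('i, 'p) name \<Rightarrow> (('i, 'p) name \<times> 'p) set" where
  "pairs (Name f) = ran f"

inductive_set names :: "'p set \<Rightarrow> ('i, 'p) name set" for P where
  "(\<And>y r. (y, r) \<in> pairs x \<Longrightarrow> y \<in> names P) \<Longrightarrow> (\<And>y r. (y, r) \<in> pairs x \<Longrightarrow> r \<in> P) \<Longrightarrow> x \<in> names P"

lemma wf_pairs: "wf {(y, x :: ('i, 'p) name). \<exists>r. (y, r) \<in> pairs x}"
proof (rule wfUNIVI)
  fix Q :: "('i, 'p) name \<Rightarrow> bool" and x
  assume step: "\<forall>x. (\<forall>y. (y, x) \<in> {(y, x). \<exists>r. (y, r) \<in> pairs x} \<longrightarrow> Q y) \<longrightarrow> Q x"
  show "Q x"
  proof (induction x)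
    case (Name f)
    show ?case
    proof (rule step[rule_format])
      fix y assume "(y, Name f) \<in> {(y, x). \<exists>r. (y, r) \<in> pairs x}"
      then obtain r i where "f i = Some (y, r)" by (auto simp: ran_def)
      then show "Q y"
        by (intro Name[of "Some (y, r)" "(y, r)" y]) (auto intro: range_eqI[of _ _ i])
    qed
  qed
qed

definition dense_below :: "'p::order set \<Rightarrow> 'p \<Rightarrow> 'p set \<Rightarrow> bool" where
  "dense_below P p D \<longleftrightarrow> (\<forall>q\<in>P. q \<le> p \<longrightarrow> (\<exists>r\<in>P. r \<le> q \<and> r \<in> D))"

text \<open>
  The forcing relation is the usual one defined in the ground model by recursion on names and then
  on formulas (as in Kunen, Set Theory, 1980, Definition VII.3.3).
\<close>

function forces_eq :: "'p::order set \<Rightarrow> ('i, 'p) name \<Rightarrow> ('i, 'p) name \<Rightarrow> 'p \<Rightarrow> bool" where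
  "forces_eq P x y p \<longleftrightarrow>
     (\<forall>(x', s) \<in> pairs x.
        dense_below P p {q. q \<le> s \<longrightarrow> (\<exists>(y', t) \<in> pairs y. q \<le> t \<and> forces_eq P x' y' q)}) \<and>
     (\<forall>(y', t) \<in> pairs y.
        dense_below P p {q. q \<le> t \<longrightarrow> (\<exists>(x', s) \<in> pairs x. q \<le> s \<and> forces_eq P x' y' q)})"
  by pat_completeness auto
termination
  by (relation "inv_image {(y, x). \<exists>r. (y, r) \<in> pairs x} (\<lambda>(P, x, y, p). x)")
    (auto intro: wf_pairs wf_inv_image)

declare forces_eq.simps [simp del]

definition forces_mem :: "'p::order set \<Rightarrow> ('i, 'p) name \<Rightarrow> ('i, 'p) name \<Rightarrow> 'p \<Rightarrow> bool" where
  "forces_mem P x y p \<longleftrightarrow>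
     dense_below P p {q. \<exists>(y', t) \<in> pairs y. q \<le> t \<and> forces_eq P y' x q}"

text \<open>Formulas of the forcing language; the variable of a quantifier is bound by abstraction.\<close>

datatype ('i, 'p) fm =
    FMem "('i, 'p) name" "('i, 'p) name"
  | FEq "('i, 'p) name" "('i, 'p) name"
  | FNeg "('i, 'p) fm"
  | FAnd "('i, 'p) fm" "('i, 'p) fm"
  | FEx "('i, 'p) name \<Rightarrow> ('i, 'p) fm"

primrec forces :: "'p::order set \<Rightarrow> ('i, 'p) fm \<Rightarrow> 'p \<Rightarrow> bool" where
  "forces P (FMem x y) = forces_mem P x y"
| "forces P (FEq x y) = forces_eq P x y"
| "forces P (FNeg \<phi>) = (\<lambda>p. \<forall>q\<in>P. q \<le> p \<longrightarrow> \<not> forces P \<phi> q)"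
| "forces P (FAnd \<phi> \<psi>) = (\<lambda>p. forces P \<phi> p \<and> forces P \<psi> p)"
| "forces P (FEx \<phi>) = (\<lambda>p. dense_below P p {q. \<exists>x\<in>names P. forces P (\<phi> x) q})"

definition FImp :: "('i, 'p) fm \<Rightarrow> ('i, 'p) fm \<Rightarrow> ('i, 'p) fm" where
  "FImp \<phi> \<psi> = FNeg (FAnd \<phi> (FNeg \<psi>))"

definition FAll :: "(('i, 'p) name \<Rightarrow> ('i, 'p) fm) \<Rightarrow> ('i, 'p) fm" where
  "FAll \<phi> = FNeg (FEx (\<lambda>x. FNeg (\<phi> x)))"

definition FBall :: "('i, 'p) name \<Rightarrow> (('i, 'p) name \<Rightarrow> ('i, 'p) fm) \<Rightarrow> ('i, 'p) fm" where
  "FBall A \<phi> = FAll (\<lambda>x. FImp (FMem x A) (\<phi> x))"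

definition FBex :: "('i, 'p) name \<Rightarrow> (('i, 'p) name \<Rightarrow> ('i, 'p) fm) \<Rightarrow> ('i, 'p) fm" where
  "FBex A \<phi> = FEx (\<lambda>x. FAnd (FMem x A) (\<phi> x))"

definition FSubset :: "('i, 'p) name \<Rightarrow> ('i, 'p) name \<Rightarrow> ('i, 'p) fm" where
  "FSubset A B = FBall A (\<lambda>x. FMem x B)"

section \<open>Canonical names for ground model sets\<close>

text \<open>
  \<open>set_name P A\<close> is the name \<open>A \<times> P\<close>, provided \<open>'i\<close> has at least as many elements as \<open>A \<times> P\<close>;
  \<open>P\<close> need not have a largest element. It is evaluated by every generic filter to the set of the
  evaluations of the elements of \<open>A\<close>.
\<close>

definition set_name :: "'p set \<Rightarrow> ('i, 'p) name set \<Rightarrow> ('i, 'p) name" where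
  "set_name P A = Name (SOME f. ran f = A \<times> P)"

definition pair_name :: "'p set \<Rightarrow> ('i, 'p) name \<Rightarrow> ('i, 'p) name \<Rightarrow> ('i, 'p) name" where
  "pair_name P x y = set_name P {set_name P {x}, set_name P {x, y}}"

text \<open>Von Neumann ordinals: \<open>a\<close> is the set of its predecessors, and \<open>2 = {0, 1}\<close>.\<close>

function ord_name :: "'p set \<Rightarrow> 'k::wellorder \<Rightarrow> ('i, 'p) name" where
  "ord_name P a = set_name P (ord_name P ` {..<a})"
  by pat_completeness auto
termination
  by (relation "inv_image {(x, y). x < y} snd") (auto intro: wf wf_inv_image)

declare ord_name.simps [simp del]

definition kappa_name :: "'p set \<Rightarrow> 'k::wellorder itself \<Rightarrow> ('i, 'p) name" where
  "kappa_name P _ = set_name P (range (ord_name P :: 'k \<Rightarrow> _))"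

definition bit_name :: "'p set \<Rightarrow> bool \<Rightarrow> ('i, 'p) name" where
  "bit_name P b = set_name P (if b then {set_name P {}} else {})"

definition two_name :: "'p set \<Rightarrow> ('i, 'p) name" where
  "two_name P = set_name P (range (bit_name P))"

definition seq_name :: "'p set \<Rightarrow> ('k::wellorder \<rightharpoonup> bool) \<Rightarrow> ('i, 'p) name" where
  "seq_name P s = set_name P {pair_name P (ord_name P a) (bit_name P b) | a b. s a = Some b}"

section \<open>Cohen reals\<close>

definition cohen_dense :: "('k::wellorder \<rightharpoonup> bool) set \<Rightarrow> bool" where
  "cohen_dense D \<longleftrightarrow> D \<subseteq> kseqs \<and> (\<forall>s\<in>kseqs. \<exists>t\<in>D. s \<subseteq>\<^sub>m t)"

text \<open>The name of the set of all dense subsets of \<open>2\<^sup><\<^sup>\<kappa>\<close> that lie in the ground model.\<close>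

definition dense_sets_name :: "'p set \<Rightarrow> 'k::wellorder itself \<Rightarrow> ('i, 'p) name" where
  "dense_sets_name P _ =
     set_name P ((\<lambda>D. set_name P (seq_name P ` D)) ` {D :: ('k \<rightharpoonup> bool) set. cohen_dense D})"

definition function_fm ::
  "'p set \<Rightarrow> ('i, 'p) name \<Rightarrow> ('i, 'p) name \<Rightarrow> ('i, 'p) name \<Rightarrow> ('i, 'p) fm" where
  "function_fm P c A B =
     FAnd (FBall c (\<lambda>z. FBex A (\<lambda>x. FBex B (\<lambda>y. FEq z (pair_name P x y)))))
      (FBall A (\<lambda>x. FBex B (\<lambda>y. FAnd (FMem (pair_name P x y) c)
         (FBall B (\<lambda>y'. FImp (FMem (pair_name P x y') c) (FEq y' y))))))"

text \<open>
  \<open>c\<close> is a function from \<open>\<kappa>\<close> to \<open>2\<close>, and the filter \<open>{s \<in> 2\<^sup><\<^sup>\<kappa>. s \<subseteq> c}\<close> meets every dense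
  set of the ground model.
\<close>

definition cohen_real_fm :: "'p set \<Rightarrow> 'k::wellorder itself \<Rightarrow> ('i, 'p) name \<Rightarrow> ('i, 'p) fm" where
  "cohen_real_fm P k c =
     FAnd (function_fm P c (kappa_name P k) (two_name P))
      (FBall (dense_sets_name P k) (\<lambda>D. FBex D (\<lambda>s. FSubset s c)))"

text \<open>
  A sentence holds in every \<open>P\<close>-generic extension iff every condition forces it. The type arguments
  are the index type of the names and the type presenting \<open>\<kappa>\<close>.
\<close>

definition adds_cohen_real ::
  "'i itself \<Rightarrow> 'k::wellorder itself \<Rightarrow> 'p::order set \<Rightarrow> bool" where
  "adds_cohen_real _ k P \<longleftrightarrow>
     (\<forall>p\<in>P. forces P (FEx (\<lambda>c :: ('i, 'p) name. cohen_real_fm P k c)) p)"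

end

theory Submission
  imports Defs
begin

text \<open>
  Fodor's lemma splits the ordinals of countable cofinality into \<open>\<kappa>\<close> stationary sets, so they can be
  coloured by \<open>2\<^sup><\<^sup>\<kappa>\<close> with every colour class stationary. Given a short Laver tree and a colour, some
  \<open>\<delta>\<close> of that colour is closed under the choice of large successors in the tree, hence is the
  supremum of an \<open>\<omega>\<close>-branch. Reading off the colours of the suprema of consecutive \<open>\<omega>\<close>-blocks, a node
  \<open>\<sigma>\<close> of a condition \<open>T\<close> codes an element of \<open>2\<^sup><\<^sup>\<kappa>\<close>, and by limit-closure some \<open>\<sigma> \<in> T\<close> codes an
  element extending a member of any given dense set; the condition \<open>T \<up> \<sigma>\<close> then decides that much of
  the Cohen real. Two conditions with a common extension have comparable trunks, since the trees
  keep splitting, so their decisions agree.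
\<close>

section \<open>Colouring ordinals of countable cofinality\<close>

text \<open>Weak monotonicity is enough, so a successor ordinal also has a ladder, constant at its
  predecessor; a limit ordinal has one exactly when its cofinality is \<omega>.\<close>

definition ladder :: "(nat \<Rightarrow> 'k::wellorder) \<Rightarrow> 'k \<Rightarrow> bool" where
  "ladder d \<delta> \<longleftrightarrow> mono d \<and> (\<forall>n. d n < \<delta>) \<and> (\<forall>\<beta><\<delta>. \<exists>n. \<beta> \<le> d n)"

definition closed_under :: "('k::wellorder list \<Rightarrow> 'k) \<Rightarrow> 'k \<Rightarrow> bool" where
  "closed_under G \<delta> \<longleftrightarrow> (\<forall>xs. set xs \<subseteq> {..<\<delta>} \<longrightarrow> G xs < \<delta>)"

text \<open>
  The sets of ordinals closed under some \<open>G\<close> generate the club filter, so this says that the points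
  of countable cofinality in \<open>A\<close> form a stationary set. Using functions of finite sequences makes
  diagonal intersections trivial: pass to \<open>\<lambda>\<gamma> # xs. G \<gamma> xs\<close>.
\<close>

definition omega_stationary :: "'k::wellorder set \<Rightarrow> bool" where
  "omega_stationary A \<longleftrightarrow> (\<forall>G. \<exists>\<delta>\<in>A. closed_under G \<delta> \<and> (\<exists>d. ladder d \<delta>))"

locale regular_uncountable =
  fixes k :: "'k::wellorder itself"
  assumes card_order: "Card_order (kappa :: 'k rel)"
    and uncountable: "natLeq <o (kappa :: 'k rel)"
    and regular: "regularCard (kappa :: 'k rel)"
begin

section \<open>Regularity in terms of bounded and unbounded sets\<close>

lemma Field_kappa: "Field (kappa :: 'k rel) = UNIV"
  by (auto simp: kappa_def Field_def)

lemma card_UNIV: "|UNIV :: 'k set| =o (kappa :: 'k rel)"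
  using card_of_Field_ordIso[OF card_order] by (simp add: Field_kappa)

lemma infinite_UNIV: "infinite (UNIV :: 'k set)"
proof
  assume "finite (UNIV :: 'k set)"
  then have "|UNIV :: 'k set| <o natLeq"
    by (simp add: finite_iff_ordLess_natLeq)
  then have "(kappa :: 'k rel) <o natLeq"
    using card_UNIV ordIso_ordLess_trans ordIso_symmetric by blast
  then show False
    using uncountable not_ordLess_ordLeq ordLess_imp_ordLeq by blast
qed

lemma ex_greater: "\<exists>b. a < (b :: 'k)"
proof -
  have "\<exists>b \<in> Field (kappa :: 'k rel). a \<noteq> b \<and> (a, b) \<in> kappa"
    by (rule infinite_Card_order_limit[OF card_order]) (auto simp: Field_kappa infinite_UNIV)
  then show ?thesis
    by (auto simp: kappa_def less_le)
qed

lemma card_lessThan: "|{..<a :: 'k}| <o (kappa :: 'k rel)"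
proof -
  have "underS (kappa :: 'k rel) a = {..<a}"
    by (auto simp: underS_def kappa_def)
  then show ?thesis
    using card_of_underS[OF card_order, of a] by (simp add: Field_kappa)
qed

lemma small_bounded:
  fixes f :: "'a \<Rightarrow> 'k"
  assumes "|A| <o (kappa :: 'k rel)"
  shows "\<exists>b. \<forall>a\<in>A. f a < b"
proof -
  have "|f ` A| <o (kappa :: 'k rel)"
    using card_of_image assms ordLeq_ordLess_trans by blast
  then have "\<not> |f ` A| =o (kappa :: 'k rel)"
    using not_ordLess_ordIso by blast
  then have "\<not> cofinal (f ` A) (kappa :: 'k rel)"
    using regular unfolding regularCard_def by (auto simp: Field_kappa)
  then obtain c where c: "\<And>a. a \<in> A \<Longrightarrow> \<not> (c \<noteq> f a \<and> c \<le> f a)"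
    unfolding cofinal_def by (auto simp: kappa_def)
  \<comment> \<open>\<open>cofinal\<close> is strict, so its failure only gives
    \<open>f a \<le> c\<close>; a larger \<open>b\<close> makes the bound strict.\<close>
  obtain b where "c < b"
    using ex_greater by blast
  with c show ?thesis
    by (metis le_less_linear le_less_trans less_le)
qed

lemma sequence_bounded:
  fixes f :: "nat \<Rightarrow> 'k"
  obtains b where "\<And>n. f n < b"
proof -
  have "|UNIV :: nat set| <o (kappa :: 'k rel)"
    using card_of_nat uncountable ordIso_ordLess_trans by blast
  then show ?thesis
    using that small_bounded[of "UNIV :: nat set" f] by blast
qed

lemma unbounded_card:
  fixes A :: "'k set"
  assumes "\<And>a. \<exists>b\<in>A. a \<le> b"
  shows "|A| =o (kappa :: 'k rel)"
proof -
  have "cofinal A (kappa :: 'k rel)"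
    unfolding cofinal_def
  proof
    fix a :: 'k
    obtain b where "a < b"
      using ex_greater by blast
    moreover obtain c where "c \<in> A" "b \<le> c"
      using assms by blast
    ultimately have "a \<noteq> c \<and> (a, c) \<in> kappa"
      by (auto simp: kappa_def)
    then show "\<exists>c\<in>A. a \<noteq> c \<and> (a, c) \<in> kappa"
      using \<open>c \<in> A\<close> by blast
  qed
  then show ?thesis
    using regular unfolding regularCard_def by (auto simp: Field_kappa)
qed

lemma card_unbounded:
  fixes A :: "'k set"
  assumes "|A| =o (kappa :: 'k rel)"
  shows "\<exists>x\<in>A. a \<le> x"
proof (rule ccontr)
  assume "\<not> ?thesis"
  then have "A \<subseteq> {..<a}"
    by auto
  then have "|A| <o (kappa :: 'k rel)"
    using card_lessThan card_of_mono1 ordLeq_ordLess_trans by blast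
  then show False
    using assms not_ordLess_ordIso by blast
qed

text \<open>Induction on the length: the hypothesis bounds the values for each first entry, and by
  regularity these fewer than \<kappa> bounds have a common bound.\<close>

lemma bounded_on_lists:
  fixes G :: "'k list \<Rightarrow> 'k"
  shows "\<exists>b. \<forall>xs. set xs \<subseteq> {..<a} \<longrightarrow> length xs = n \<longrightarrow> G xs < b"
proof (induction n arbitrary: G)
  case 0
  then show ?case
    using ex_greater[of "G []"] by auto
next
  case (Suc n)
  have "\<exists>b. \<forall>xs. set xs \<subseteq> {..<a} \<longrightarrow> length xs = n \<longrightarrow> G (x # xs) < b" for x
    by (rule Suc.IH)
  then obtain b where b: "\<And>x xs. set xs \<subseteq> {..<a} \<Longrightarrow> length xs = n \<Longrightarrow> G (x # xs) < b x"
    by metis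
  obtain c where c: "\<And>x. x \<in> {..<a} \<Longrightarrow> b x < c"
    using small_bounded[OF card_lessThan, of a b] by blast
  have "G xs < c" if "set xs \<subseteq> {..<a}" "length xs = Suc n" for xs
    using that b c by (cases xs) (auto intro: less_trans)
  then show ?case
    by blast
qed

text \<open>A step \<open>s\<close> that jumps above all values of \<open>G\<close> on lists below
  its argument is iterated \<omega> times. A finite list below the supremum lies below one of the
  iterates, so the supremum is closed under \<open>G\<close>.\<close>

lemma omega_stationary_UNIV: "omega_stationary (UNIV :: 'k set)"
  unfolding omega_stationary_def
proof
  fix G :: "'k list \<Rightarrow> 'k"
  \<comment> \<open>Each list length has its own bound; countably many of them are again
    bounded.\<close>
  have "\<exists>b. a < b \<and> (\<forall>xs. set xs \<subseteq> {..<a} \<longrightarrow> G xs < b)" for a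
  proof -
    obtain c where c: "\<And>n xs. set xs \<subseteq> {..<a} \<Longrightarrow> length xs = n \<Longrightarrow> G xs < c n"
      using bounded_on_lists[of a _ G] by metis
    obtain b where "\<And>n. c n < b"
      using sequence_bounded by blast
    moreover obtain b' where "a < b'"
      using ex_greater by blast
    ultimately have "a < max b b'" "set xs \<subseteq> {..<a} \<longrightarrow> G xs < max b b'" for xs
      using c by (auto simp: less_max_iff_disj intro: less_trans)
    then show ?thesis
      by blast
  qed
  then obtain s where s: "\<And>a. a < s a" "\<And>a xs. set xs \<subseteq> {..<a} \<Longrightarrow> G xs < s a"
    by metis
  \<comment> \<open>Any starting point will do.\<close>
  define d where "d = (\<lambda>n. (s ^^ n) undefined)"
  have d_Suc: "d (Suc n) = s (d n)" for n
    by (simp add: d_def)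
  have "strict_mono d"
    by (simp add: strict_mono_Suc_iff d_Suc s)
  obtain c where c: "\<And>n. d n < c"
    using sequence_bounded by blast
  define \<delta> where "\<delta> = (LEAST c. \<forall>n. d n < c)"
  have less: "d n < \<delta>" for n
    unfolding \<delta>_def by (rule LeastI2[of _ c]) (auto simp: c)
  have cof: "\<exists>n. \<beta> \<le> d n" if "\<beta> < \<delta>" for \<beta>
    using not_less_Least[OF that[unfolded \<delta>_def]] by (auto simp: not_less)
  have "ladder d \<delta>"
    using \<open>strict_mono d\<close> less cof by (auto simp: ladder_def strict_mono_mono)
  moreover have "closed_under G \<delta>"
    unfolding closed_under_def
  proof (intro allI impI)
    fix xs assume "set xs \<subseteq> {..<\<delta>}"
    then have "\<exists>n. set xs \<subseteq> {..<d n}"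
    proof (induction xs)
      case (Cons x xs)
      then obtain n m where "set xs \<subseteq> {..<d n}" "x \<le> d m"
        using cof by fastforce
      moreover have "d n \<le> d (max n (Suc m))" "d m < d (max n (Suc m))"
        using \<open>strict_mono d\<close> by (simp_all add: strict_mono_less_eq strict_mono_less)
      ultimately have "set (x # xs) \<subseteq> {..<d (max n (Suc m))}"
        by (auto intro: less_le_trans le_less_trans)
      then show ?case
        by blast
    qed simp
    then obtain n where "set xs \<subseteq> {..<d n}"
      by blast
    then have "G xs < d (Suc n)"
      by (simp add: d_Suc s)
    then show "G xs < \<delta>"
      using less less_trans by blast
  qed
  ultimately show "\<exists>\<delta>\<in>UNIV. closed_under G \<delta> \<and> (\<exists>d. ladder d \<delta>)"
    by blast
qed

text \<open>Countable completeness of the club filter: if each component \<open>n\<close> were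
  bounded by \<open>\<eta> n\<close> on the ladder points closed under \<open>G n\<close>, one
  function dominating all of these would give a point whose whole ladder stays below a fixed smaller
  ordinal \<open>\<theta>\<close>.\<close>

lemma ladder_component_unbounded:
  fixes a :: "'k \<Rightarrow> nat \<Rightarrow> 'k"
  assumes "\<And>\<delta> d. ladder d \<delta> \<Longrightarrow> ladder (a \<delta>) \<delta>"
  shows "\<exists>n. \<forall>\<eta>. omega_stationary {\<delta>. \<eta> \<le> a \<delta> n}"
proof (rule ccontr)
  assume "\<not> ?thesis"
  then have "\<forall>n. \<exists>\<eta> G. \<forall>\<delta>. closed_under G \<delta> \<and> (\<exists>d. ladder d \<delta>) \<longrightarrow> a \<delta> n < \<eta>"
    unfolding omega_stationary_def by (auto simp: not_le) (metis not_le)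
  then obtain \<eta> G where G: "\<And>n \<delta> d. closed_under (G n) \<delta> \<Longrightarrow> ladder d \<delta> \<Longrightarrow> a \<delta> n < \<eta> n"
    by metis
  obtain \<theta> where \<theta>: "\<And>n. \<eta> n < \<theta>"
    using sequence_bounded by blast
  have "\<exists>b. \<forall>n. G n xs < b" for xs
    using sequence_bounded[of "\<lambda>n. G n xs"] by metis
  then obtain H where H: "\<And>n xs. G n xs < H xs"
    by metis
  obtain \<delta> d where \<delta>: "closed_under (\<lambda>xs. max \<theta> (H xs)) \<delta>" "ladder d \<delta>"
    using omega_stationary_UNIV unfolding omega_stationary_def by blast
  \<comment> \<open>Closure applied to the empty list gives a lower bound for
    \<open>\<delta>\<close>.\<close>
  have "\<theta> < \<delta>"
    using \<delta>(1)[unfolded closed_under_def, rule_format, of "[]"] by simp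
  moreover have lad: "ladder (a \<delta>) \<delta>"
    using assms \<delta>(2) .
  ultimately obtain n where "\<theta> \<le> a \<delta> n"
    unfolding ladder_def by blast
  moreover have "closed_under (G n) \<delta>"
    using \<delta>(1) H unfolding closed_under_def by (meson less_trans max_less_iff_conj)
  then have "a \<delta> n < \<eta> n"
    using G lad by blast
  ultimately show False
    using \<theta>[of n] by auto
qed

text \<open>A component of a choice of ladders is regressive, so Fodor's argument applies to it.\<close>

lemma omega_stationary_partition:
  "\<exists>f :: 'k \<Rightarrow> 'k. \<forall>\<eta>. \<exists>\<gamma>\<ge>\<eta>. omega_stationary {\<delta>. f \<delta> = \<gamma>}"
proof -
  define a :: "'k \<Rightarrow> nat \<Rightarrow> 'k" where "a = (\<lambda>\<delta>. SOME d. ladder d \<delta>)"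
  have a: "ladder (a \<delta>) \<delta>" if "ladder d \<delta>" for \<delta> d
    unfolding a_def by (rule someI[of "\<lambda>d. ladder d \<delta>" d]) (rule that)
  then obtain n where n: "\<And>\<eta>. omega_stationary {\<delta>. \<eta> \<le> a \<delta> n}"
    using ladder_component_unbounded[of a] by blast
  have "\<exists>\<gamma>\<ge>\<eta>. omega_stationary {\<delta>. a \<delta> n = \<gamma>}" for \<eta>
  proof (rule ccontr)
    assume "\<not> ?thesis"
    then have "\<forall>\<gamma>. \<exists>G. \<eta> \<le> \<gamma> \<longrightarrow> (\<forall>\<delta>. a \<delta> n = \<gamma> \<longrightarrow> \<not> (closed_under G \<delta> \<and> (\<exists>d. ladder d \<delta>)))"
      unfolding omega_stationary_def by blast
    then obtain G where
      G: "\<And>\<gamma> \<delta> d. \<eta> \<le> \<gamma> \<Longrightarrow> a \<delta> n = \<gamma> \<Longrightarrow> closed_under (G \<gamma>) \<delta> \<Longrightarrow> \<not> ladder d \<delta>"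
      by metis
    \<comment> \<open>The first list entry selects the witness: this \<open>\<delta>\<close> is
      closed under \<open>G \<gamma>\<close> for every \<open>\<gamma> < \<delta>\<close>, in
      particular for its own value \<open>a \<delta> n\<close>.\<close>
    obtain \<delta> d where \<delta>: "\<eta> \<le> a \<delta> n" "closed_under (\<lambda>xs. G (hd xs) (tl xs)) \<delta>" "ladder d \<delta>"
      using n unfolding omega_stationary_def by blast
    have "a \<delta> n < \<delta>"
      using a[OF \<delta>(3)] by (simp add: ladder_def)
    then have "closed_under (G (a \<delta> n)) \<delta>"
      unfolding closed_under_def
      using \<delta>(2)[unfolded closed_under_def, rule_format, of "a \<delta> n # xs" for xs] by simp
    then show False
      using G \<delta> by blast
  qed
  then show ?thesis
    by (intro exI[of _ "\<lambda>\<delta>. a \<delta> n"]) blast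
qed

text \<open>There are \<kappa> many stationary fibres, since their indices are unbounded. The map
  \<open>g\<close> sends these indices onto the colours, and all other points get a default colour
  \<open>s\<close>.\<close>

lemma stationary_colouring:
  fixes S :: "'s set"
  assumes "|S| \<le>o (kappa :: 'k rel)" "S \<noteq> {}"
  obtains col :: "'k \<Rightarrow> 's" where "\<And>\<delta>. col \<delta> \<in> S" "\<And>t. t \<in> S \<Longrightarrow> omega_stationary {\<delta>. col \<delta> = t}"
proof -
  obtain f :: "'k \<Rightarrow> 'k" where f: "\<And>\<eta>. \<exists>\<gamma>\<ge>\<eta>. omega_stationary {\<delta>. f \<delta> = \<gamma>}"
    using omega_stationary_partition by blast
  define \<Gamma> where "\<Gamma> = {\<gamma>. omega_stationary {\<delta>. f \<delta> = \<gamma>}}"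
  have "|\<Gamma>| =o (kappa :: 'k rel)"
    by (rule unbounded_card) (use f in \<open>auto simp: \<Gamma>_def\<close>)
  then have "|S| \<le>o |\<Gamma>|"
    using assms(1) ordIso_symmetric ordLeq_ordIso_trans by blast
  then obtain g where g: "g ` \<Gamma> = S"
    unfolding card_of_ordLeq2[OF assms(2), symmetric] by blast
  obtain s where "s \<in> S"
    using assms(2) by blast
  define col where "col = (\<lambda>\<delta>. if f \<delta> \<in> \<Gamma> then g (f \<delta>) else s)"
  show ?thesis
  proof
    show "col \<delta> \<in> S" for \<delta>
      using g \<open>s \<in> S\<close> by (auto simp: col_def)
    fix t assume "t \<in> S"
    then obtain \<gamma> where "\<gamma> \<in> \<Gamma>" "g \<gamma> = t"
      using g by blast
    then have "{\<delta>. f \<delta> = \<gamma>} \<subseteq> {\<delta>. col \<delta> = t}" "omega_stationary {\<delta>. f \<delta> = \<gamma>}"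
      by (auto simp: col_def \<Gamma>_def)
    then show "omega_stationary {\<delta>. col \<delta> = t}"
      unfolding omega_stationary_def by blast
  qed
qed

end

section \<open>Decoding a binary sequence from a node\<close>

lemma dom_kseqs: "\<sigma> \<in> kseqs \<Longrightarrow> dom \<sigma> = {..<seq_len \<sigma>}"
proof -
  assume "\<sigma> \<in> kseqs"
  then obtain a where a: "dom \<sigma> = {..<a}"
    by (auto simp: kseqs_def)
  have "(LEAST b. b \<notin> {..<a}) = a"
    by (rule Least_equality) auto
  then show ?thesis
    unfolding seq_len_def a by simp
qed

lemma seq_append_append: "seq_append \<sigma> (xs @ ys) = seq_append (seq_append \<sigma> xs) ys"
  by (induction xs arbitrary: \<sigma>) auto

text \<open>A downward closed set of positions is an initial segment; the bound \<open>c\<close>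
  excludes the whole of \<open>'k\<close>, which is not of the form \<open>{..<a}\<close>.\<close>

lemma kseqs_downward_closed:
  assumes "\<And>a b. a \<in> dom \<sigma> \<Longrightarrow> b < a \<Longrightarrow> b \<in> dom \<sigma>" "dom \<sigma> \<subseteq> {..<c}"
  shows "\<sigma> \<in> kseqs"
proof -
  define a where "a = (LEAST a. a \<notin> dom \<sigma>)"
  have "c \<notin> dom \<sigma>"
    using assms(2) by auto
  then have "a \<notin> dom \<sigma>"
    unfolding a_def by (rule LeastI)
  then have "dom \<sigma> \<subseteq> {..<a}"
    using assms(1) by (metis lessThan_iff not_less_iff_gr_or_eq subsetI)
  moreover have "{..<a} \<subseteq> dom \<sigma>"
    using not_less_Least unfolding a_def by blast
  ultimately show ?thesis
    by (auto simp: kseqs_def)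
qed

lemma map_le_same: "\<sigma> \<subseteq>\<^sub>m \<tau> \<Longrightarrow> x \<in> dom \<sigma> \<Longrightarrow> \<tau> x = \<sigma> x"
  by (metis map_le_def)

text \<open>
  The value is the upper limit of the entries of \<open>\<sigma>\<close> below \<open>l\<close>, increased by one if attained;
  only its dependence on the tail matters, since the Laver tree above a node has a stem whose
  entries are not under control.
\<close>

definition lim_val :: "('k::wellorder \<rightharpoonup> 'k) \<Rightarrow> 'k \<Rightarrow> 'k" where
  "lim_val \<sigma> l = (LEAST d. \<exists>m<l. \<forall>j. m \<le> j \<longrightarrow> j < l \<longrightarrow> the (\<sigma> j) < d)"

lemma lim_val_map_le:
  assumes "\<sigma> \<subseteq>\<^sub>m \<tau>" "{..<l} \<subseteq> dom \<sigma>"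
  shows "lim_val \<tau> l = lim_val \<sigma> l"
proof -
  have "\<tau> j = \<sigma> j" if "j < l" for j
    using map_le_same[OF assms(1), of j] assms(2) that by auto
  then show ?thesis
    unfolding lim_val_def by (simp cong: imp_cong)
qed

text \<open>
  Each limit \<open>l\<close> up to the length of \<open>\<sigma>\<close> proposes the sequence \<open>col (lim_val \<sigma> l)\<close>, and a bit is
  taken from the first proposal that contains it. A new proposal extending what has been decoded so
  far is therefore accepted as it stands.
\<close>

definition proposals ::
  "('k::wellorder \<Rightarrow> ('k \<rightharpoonup> bool)) \<Rightarrow> ('k \<rightharpoonup> 'k) \<Rightarrow> 'k \<Rightarrow> 'k set" where
  "proposals col \<sigma> a = {l. is_limit l \<and> {..<l} \<subseteq> dom \<sigma> \<and> a \<in> dom (col (lim_val \<sigma> l))}"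

definition decode :: "('k::wellorder \<Rightarrow> ('k \<rightharpoonup> bool)) \<Rightarrow> ('k \<rightharpoonup> 'k) \<Rightarrow> ('k \<rightharpoonup> bool)" where
  "decode col \<sigma> a = (if proposals col \<sigma> a = {} then None
     else col (lim_val \<sigma> (LEAST l. l \<in> proposals col \<sigma> a)) a)"

lemma proposals_map_le:
  assumes "\<sigma> \<subseteq>\<^sub>m \<tau>" "{..<l} \<subseteq> dom \<sigma>"
  shows "l \<in> proposals col \<tau> a \<longleftrightarrow> l \<in> proposals col \<sigma> a"
  using assms map_le_implies_dom_le[OF assms(1)]
  by (auto simp: proposals_def lim_val_map_le[OF assms])

lemma dom_decode: "a \<in> dom (decode col \<sigma>) \<longleftrightarrow> proposals col \<sigma> a \<noteq> {}"
proof (cases "proposals col \<sigma> a = {}")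
  case False
  then have "(LEAST l. l \<in> proposals col \<sigma> a) \<in> proposals col \<sigma> a"
    by (metis LeastI ex_in_conv)
  then show ?thesis
    using False by (auto simp: decode_def proposals_def domIff simp del: not_None_eq)
qed (simp add: decode_def domIff)

lemma decode_eq:
  assumes "l \<in> proposals col \<sigma> a" "\<And>l'. l' \<in> proposals col \<sigma> a \<Longrightarrow> l \<le> l'"
  shows "decode col \<sigma> a = col (lim_val \<sigma> l) a"
proof -
  have "(LEAST l. l \<in> proposals col \<sigma> a) = l"
    using assms by (rule Least_equality)
  then show ?thesis
    using assms(1) by (auto simp: decode_def)
qed

text \<open>Limits \<open>l\<close> with \<open>{..<l}\<close> inside \<open>dom \<sigma>\<close>
  make the same proposals for \<open>\<tau>\<close>, and any further limit of \<open>\<tau>\<close>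
  is later; so the first proposal for a decided bit stays first.\<close>

lemma decode_mono:
  assumes "\<sigma> \<subseteq>\<^sub>m \<tau>"
  shows "decode col \<sigma> \<subseteq>\<^sub>m decode col \<tau>"
  unfolding map_le_def
proof
  fix a assume "a \<in> dom (decode col \<sigma>)"
  then have ne: "proposals col \<sigma> a \<noteq> {}"
    by (simp add: dom_decode)
  define l where "l = (LEAST l. l \<in> proposals col \<sigma> a)"
  have l: "l \<in> proposals col \<sigma> a" "\<And>l'. l' \<in> proposals col \<sigma> a \<Longrightarrow> l \<le> l'"
    using ne unfolding l_def by (metis LeastI ex_in_conv, metis Least_le)
  have sub: "{..<l} \<subseteq> dom \<sigma>"
    using l(1) by (simp add: proposals_def)
  have "l \<le> l'" if l': "l' \<in> proposals col \<tau> a" for l'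
  proof (rule ccontr)
    assume "\<not> l \<le> l'"
    then have "{..<l'} \<subseteq> {..<l}"
      by auto
    then have "{..<l'} \<subseteq> dom \<sigma>"
      using sub by (rule order_trans)
    then have "l' \<in> proposals col \<sigma> a"
      using proposals_map_le[OF assms] l' by blast
    then show False
      using l(2) \<open>\<not> l \<le> l'\<close> by blast
  qed
  moreover have "l \<in> proposals col \<tau> a"
    using proposals_map_le[OF assms sub] l(1) by blast
  ultimately show "decode col \<sigma> a = decode col \<tau> a"
    using decode_eq[OF l] decode_eq[of l col \<tau> a] lim_val_map_le[OF assms sub] by simp
qed

text \<open>By \<open>old\<close>, no limit before \<open>l\<close> is new over
  \<open>\<tau>\<close>. Hence a bit left open by \<open>\<tau>\<close> is first proposed at
  \<open>l\<close>, while bits decoded from \<open>\<tau>\<close> persist and agree with the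
  proposal by \<open>ext\<close>.\<close>

lemma decode_accept:
  assumes "\<tau> \<subseteq>\<^sub>m \<sigma>" "is_limit l" "dom \<sigma> = {..<l}"
    and old: "\<And>l'. is_limit l' \<Longrightarrow> l' < l \<Longrightarrow> {..<l'} \<subseteq> dom \<tau>"
    and ext: "decode col \<tau> \<subseteq>\<^sub>m col (lim_val \<sigma> l)"
  shows "col (lim_val \<sigma> l) \<subseteq>\<^sub>m decode col \<sigma>"
  unfolding map_le_def
proof
  fix a assume a: "a \<in> dom (col (lim_val \<sigma> l))"
  show "col (lim_val \<sigma> l) a = decode col \<sigma> a"
  proof (cases "a \<in> dom (decode col \<tau>)")
    case True
    then have "decode col \<sigma> a = decode col \<tau> a"
      using map_le_same[OF decode_mono[OF assms(1)]] by blast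
    with True show ?thesis
      using map_le_same[OF ext] by simp
  next
    case False
    have "l \<in> proposals col \<sigma> a"
      using a assms(2,3) by (simp add: proposals_def)
    moreover have "l \<le> l'" if "l' \<in> proposals col \<sigma> a" for l'
    proof (rule ccontr)
      assume "\<not> l \<le> l'"
      then have "{..<l'} \<subseteq> dom \<tau>"
        using old that by (auto simp: proposals_def)
      then have "l' \<in> proposals col \<tau> a"
        using proposals_map_le[OF assms(1)] that by blast
      then show False
        using False dom_decode by blast
    qed
    ultimately show ?thesis
      using decode_eq by metis
  qed
qed

context regular_uncountable
begin

text \<open>Fewer than \<kappa> limits make proposals, each of length below \<kappa>, so regularity
  bounds the decoded length.\<close>

lemma decode_kseqs:
  assumes "\<sigma> \<in> (kseqs :: ('k \<rightharpoonup> 'k) set)" "\<And>\<delta>. col \<delta> \<in> kseqs"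
  shows "decode col \<sigma> \<in> kseqs"
proof -
  define b where "b = seq_len \<sigma>"
  have b: "dom \<sigma> = {..<b}"
    using dom_kseqs[OF assms(1)] by (simp add: b_def)
  have col: "dom (col \<delta>) = {..<seq_len (col \<delta>)}" for \<delta>
    using dom_kseqs assms(2) by blast
  \<comment> \<open>The length \<open>b\<close> may itself be a limit making a proposal, so it has
    to be included in the range.\<close>
  obtain b' where "b < b'"
    using ex_greater by blast
  obtain c where c: "\<And>l. l \<in> {..<b'} \<Longrightarrow> seq_len (col (lim_val \<sigma> l)) < c"
    using small_bounded[OF card_lessThan, of b' "\<lambda>l. seq_len (col (lim_val \<sigma> l))"] by blast
  show ?thesis
  proof (rule kseqs_downward_closed)
    show "a' \<in> dom (decode col \<sigma>)" if "a \<in> dom (decode col \<sigma>)" "a' < a" for a a'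
      using that by (auto simp: dom_decode proposals_def col)
    show "dom (decode col \<sigma>) \<subseteq> {..<c}"
    proof
      fix a assume "a \<in> dom (decode col \<sigma>)"
      then obtain l where l: "{..<l} \<subseteq> {..<b}" "a < seq_len (col (lim_val \<sigma> l))"
        by (auto simp: dom_decode proposals_def b col)
      then have "l \<le> b"
        by (metis lessThan_iff less_irrefl not_le subsetD)
      then have "l \<in> {..<b'}"
        using \<open>b < b'\<close> by auto
      then show "a \<in> {..<c}"
        using c[of l] l(2) by auto
    qed
  qed
qed

section \<open>Successors, and \<omega>-branches with a prescribed limit value\<close>

definition succ :: "'k \<Rightarrow> 'k" where
  "succ a = (LEAST b. a < b)"

lemma less_succ: "a < succ a"
  unfolding succ_def using ex_greater by (rule LeastI_ex)

lemma less_succ_iff: "b < succ a \<longleftrightarrow> b \<le> a"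
  using less_succ[of a] not_less_Least[of b "\<lambda>b. a < b"] unfolding succ_def
  by (meson le_less_trans not_le)

lemma not_limit_succ: "\<not> is_limit (succ a)"
  using less_succ unfolding is_limit_def less_succ_iff by (metis not_le)

lemma
  fixes \<sigma> :: "'k \<rightharpoonup> 'a"
  assumes "\<sigma> \<in> kseqs"
  shows dom_update: "dom (\<sigma>(seq_len \<sigma> \<mapsto> x)) = {..<succ (seq_len \<sigma>)}"
    and map_le_update: "\<sigma> \<subseteq>\<^sub>m \<sigma>(seq_len \<sigma> \<mapsto> x)"
proof -
  show "dom (\<sigma>(seq_len \<sigma> \<mapsto> x)) = {..<succ (seq_len \<sigma>)}"
    using dom_kseqs[OF assms] by (auto simp: less_succ_iff)
  show "\<sigma> \<subseteq>\<^sub>m \<sigma>(seq_len \<sigma> \<mapsto> x)"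
    using dom_kseqs[OF assms] by (auto simp: map_le_def)
qed

lemma seq_len_eq: "dom \<sigma> = {..<a :: 'k} \<Longrightarrow> seq_len \<sigma> = a"
  unfolding seq_len_def by (rule Least_equality) auto

text \<open>Above \<open>\<tau>\<close> a successor can be chosen beyond any bound. For a \<delta>
  in \<open>A\<close> closed under these choices, an \<omega>-branch is built whose entries stay
  below \<delta> but dominate a ladder of \<delta>; its union is in \<open>T\<close> by
  limit-closure.\<close>

lemma omega_branch:
  fixes T :: "('k \<rightharpoonup> 'k) set"
  assumes T: "is_tree T" "limit_closed T" and "\<tau> \<in> T"
    and split: "\<And>xs a. seq_append \<tau> xs \<in> T \<Longrightarrow> \<exists>x\<ge>a. seq_append \<tau> (xs @ [x]) \<in> T"
    and A: "omega_stationary A"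
  obtains \<sigma> l where "\<sigma> \<in> T" "\<tau> \<subseteq>\<^sub>m \<sigma>" "is_limit l" "dom \<sigma> = {..<l}" "lim_val \<sigma> l \<in> A"
    "\<And>l'. is_limit l' \<Longrightarrow> l' < l \<Longrightarrow> {..<l'} \<subseteq> dom \<tau>"
proof -
  \<comment> \<open>The bound \<open>a\<close> is passed as the head of the list, so that closure of
    \<delta> under \<open>G\<close> takes account of the bound together with the entries chosen so
    far.\<close>
  have "\<exists>G. \<forall>a xs. seq_append \<tau> xs \<in> T \<longrightarrow> a \<le> G (a # xs) \<and> seq_append \<tau> (xs @ [G (a # xs)]) \<in> T"
  proof -
    have "\<forall>ys. \<exists>x. seq_append \<tau> (tl ys) \<in> T \<longrightarrow> hd ys \<le> x \<and> seq_append \<tau> (tl ys @ [x]) \<in> T"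
      using split by blast
    then obtain G where G: "\<And>ys. seq_append \<tau> (tl ys) \<in> T \<Longrightarrow>
        hd ys \<le> G ys \<and> seq_append \<tau> (tl ys @ [G ys]) \<in> T"
      by metis
    show ?thesis
    proof (intro exI[of _ G] allI impI)
      fix a xs assume "seq_append \<tau> xs \<in> T"
      then show "a \<le> G (a # xs) \<and> seq_append \<tau> (xs @ [G (a # xs)]) \<in> T"
        using G[of "a # xs"] by simp
    qed
  qed
  then obtain G where
    G: "\<And>a xs. seq_append \<tau> xs \<in> T \<Longrightarrow> a \<le> G (a # xs) \<and> seq_append \<tau> (xs @ [G (a # xs)]) \<in> T"
    by blast
  obtain \<delta> d where \<delta>: "\<delta> \<in> A" "closed_under G \<delta>" "ladder d \<delta>"
    using A unfolding omega_stationary_def by blast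
  \<comment> \<open>The entry chosen at stage \<open>n\<close> is at least the ladder point
    \<open>d n\<close>.\<close>
  define xs where "xs = rec_nat [] (\<lambda>n ys. ys @ [G (d n # ys)])"
  define x where "x = (\<lambda>n. G (d n # xs n))"
  have xs: "xs 0 = []" "xs (Suc n) = xs n @ [x n]" for n
    by (simp_all add: xs_def x_def)
  define s where "s = (\<lambda>n. seq_append \<tau> (xs n))"
  define m where "m n = seq_len (s n)" for n
  have sT: "s n \<in> T" for n
    by (induction n) (use \<open>\<tau> \<in> T\<close> G in \<open>auto simp: s_def xs x_def\<close>)
  have s_kseqs: "s n \<in> kseqs" for n
    using sT T(1) by (auto simp: is_tree_def)
  have s_0: "s 0 = \<tau>"
    by (simp add: s_def xs)
  have s_Suc: "s (Suc n) = (s n)(m n \<mapsto> x n)" for n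
    by (simp add: s_def xs seq_append_append m_def)
  have dom_s: "dom (s n) = {..<m n}" for n
    unfolding m_def by (rule dom_kseqs[OF s_kseqs])
  have m_Suc: "m (Suc n) = succ (m n)" for n
    unfolding m_def[of "Suc n"] using dom_update[OF s_kseqs, of n "x n"]
    by (intro seq_len_eq) (simp add: s_Suc m_def)
  have s_mono: "s i \<subseteq>\<^sub>m s j" if "i \<le> j" for i j
    using that
  proof (induction rule: dec_induct)
    case (step n)
    show ?case
      unfolding s_Suc m_def using step.IH map_le_update[OF s_kseqs] by (rule map_le_trans)
  qed simp
  have m_mono: "strict_mono m"
    by (simp add: strict_mono_Suc_iff m_Suc less_succ)
  have x_less: "x n < \<delta>" and d_le: "d n \<le> x n" for n
  proof -
    have d: "d n < \<delta>" for n
      using \<delta>(3) by (simp add: ladder_def)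
    have "set (xs n) \<subseteq> {..<\<delta>}"
    proof (induction n)
      case (Suc n)
      then have "G (d n # xs n) < \<delta>"
        using \<delta>(2) d[of n] by (auto simp: closed_under_def)
      with Suc show ?case
        by (simp add: xs x_def)
    qed (simp add: xs)
    then show "x n < \<delta>"
      using \<delta>(2) d[of n] by (auto simp: closed_under_def x_def)
    show "d n \<le> x n"
      using G[of "xs n" "d n"] sT[of n] by (simp add: x_def s_def)
  qed
  obtain c where c: "\<And>n. m n < c"
    using sequence_bounded by blast
  \<comment> \<open>The supremum of the lengths of the stages, which is the length of
    \<open>\<tau>\<close> plus \<omega>.\<close>
  define l where "l = (LEAST c. \<forall>n. m n < c)"
  have m_less: "m n < l" for n
    unfolding l_def by (rule LeastI2[of _ c]) (auto simp: c)
  have cof: "\<exists>n. a \<le> m n" if "a < l" for a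
    using not_less_Least[OF that[unfolded l_def]] by (auto simp: not_less)
  \<comment> \<open>The lengths grow by one at each stage, so they exhaust the interval from
    \<open>m 0\<close> to \<open>l\<close>.\<close>
  have between: "\<exists>n. a = m n" if "m 0 \<le> a" "a < l" for a
  proof -
    define n where "n = (LEAST n. a \<le> m n)"
    have n: "a \<le> m n"
      unfolding n_def using cof[OF that(2)] by (rule LeastI_ex)
    show ?thesis
    proof (cases n)
      case 0
      then show ?thesis
        using n that(1) by auto
    next
      case (Suc n')
      then have "\<not> a \<le> m n'"
        using not_less_Least[of n' "\<lambda>n. a \<le> m n"] by (simp add: n_def)
      then have "a = m n"
        using n unfolding Suc m_Suc by (metis less_succ_iff linorder_not_le order_antisym)
      then show ?thesis ..
    qed
  qed
  have lim: "is_limit l"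
    unfolding is_limit_def
  proof (intro conjI allI impI)
    show "\<exists>a. a < l"
      using m_less by blast
    fix a assume "a < l"
    then obtain n where "a \<le> m n"
      using cof by blast
    also have "m n < m (Suc n)"
      using m_mono by (simp add: strict_mono_less)
    finally show "\<exists>b<l. a < b"
      using m_less by blast
  qed
  \<comment> \<open>\<open>limit_closed\<close> asks for a family indexed by the ordinals below a
    limit, so the \<omega> stages are spread over \<open>{..<l}\<close>: index \<open>a\<close> gets
    the first stage of length at least \<open>a\<close>.\<close>
  define N where "N a = (LEAST n. a \<le> m n)" for a
  have N: "a \<le> m (N a)" if "a < l" for a
    unfolding N_def using cof[OF that] by (rule LeastI_ex)
  have N_mono: "N a \<le> N b" if "a < b" "b < l" for a b
    unfolding N_def[of a] using N[OF that(2)] that(1) by (intro Least_le) auto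
  have "\<forall>a<l. s (N a) \<in> T" "\<forall>b<l. \<forall>a<b. s (N a) \<subseteq>\<^sub>m s (N b)"
    using sT N_mono s_mono by auto
  then obtain \<sigma> where \<sigma>: "\<sigma> \<in> T" "Map.graph \<sigma> = (\<Union>a\<in>{..<l}. Map.graph (s (N a)))"
    using T(2)[unfolded limit_closed_def, rule_format, of l "\<lambda>a. s (N a)"] lim by blast
  have le: "s n \<subseteq>\<^sub>m \<sigma>" for n
  proof -
    have "n \<le> N (m n)"
      using N[OF m_less, of n] m_mono by (simp add: strict_mono_less_eq)
    then have "s n \<subseteq>\<^sub>m s (N (m n))"
      by (rule s_mono)
    moreover have "s (N (m n)) \<subseteq>\<^sub>m \<sigma>"
    proof -
      have "Map.graph (s (N (m n))) \<subseteq> Map.graph \<sigma>"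
        using \<sigma>(2) m_less by blast
      then show ?thesis
        by (auto simp: map_le_def Map.graph_def dom_def)
    qed
    ultimately show ?thesis
      by (rule map_le_trans)
  qed
  have dom_\<sigma>: "dom \<sigma> = {..<l}"
  proof
    show "dom \<sigma> \<subseteq> {..<l}"
    proof
      fix j assume "j \<in> dom \<sigma>"
      then obtain y where "(j, y) \<in> Map.graph \<sigma>"
        by (auto simp: Map.graph_def)
      then obtain a where "(j, y) \<in> Map.graph (s (N a))"
        using \<sigma>(2) by blast
      then have "j \<in> dom (s (N a))"
        by (auto simp: Map.graph_def)
      then have "j < m (N a)"
        by (simp only: dom_s lessThan_iff)
      then show "j \<in> {..<l}"
        using m_less less_trans by blast
    qed
    show "{..<l} \<subseteq> dom \<sigma>"
    proof
      fix j assume "j \<in> {..<l}"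
      then obtain n where "j \<le> m n"
        using cof by blast
      then have "j \<in> dom (s (Suc n))"
        by (simp add: dom_s m_Suc less_succ_iff)
      then show "j \<in> dom \<sigma>"
        using map_le_implies_dom_le[OF le[of "Suc n"]] by blast
    qed
  qed
  have \<sigma>_m: "\<sigma> (m n) = Some (x n)" for n
    using map_le_same[OF le[of "Suc n"], of "m n", unfolded s_Suc] by simp
  \<comment> \<open>From position \<open>m 0\<close> on the entries are the \<open>x n\<close>. They
    lie below \<delta> and dominate its ladder, so \<delta> is their least eventual strict
    bound.\<close>
  have "lim_val \<sigma> l = \<delta>"
    unfolding lim_val_def
  proof (rule Least_equality)
    show "\<exists>i<l. \<forall>j. i \<le> j \<longrightarrow> j < l \<longrightarrow> the (\<sigma> j) < \<delta>"
    proof (intro exI[of _ "m 0"] conjI allI impI m_less)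
      fix j assume "m 0 \<le> j" "j < l"
      then obtain n where "j = m n"
        using between by blast
      then show "the (\<sigma> j) < \<delta>"
        by (simp add: \<sigma>_m x_less)
    qed
    fix e assume "\<exists>i<l. \<forall>j. i \<le> j \<longrightarrow> j < l \<longrightarrow> the (\<sigma> j) < e"
    then obtain i where i: "i < l" "\<And>j. i \<le> j \<Longrightarrow> j < l \<Longrightarrow> the (\<sigma> j) < e"
      by blast
    obtain n where n: "i \<le> m n"
      using cof i(1) by blast
    show "\<delta> \<le> e"
    proof (rule ccontr)
      assume "\<not> \<delta> \<le> e"
      then obtain p where p: "e \<le> d p"
        using \<delta>(3) by (auto simp: ladder_def not_le)
      have "e \<le> d (max n p)"
        using p \<delta>(3) by (meson ladder_def max.cobounded2 monoD order_trans)
      also have "\<dots> \<le> x (max n p)"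
        by (rule d_le)
      also have "\<dots> < e"
      proof -
        have "m n \<le> m (max n p)"
          using m_mono by (simp add: strict_mono_less_eq)
        then show ?thesis
          using i(2)[of "m (max n p)"] n m_less by (simp add: \<sigma>_m)
      qed
      finally show False
        by simp
    qed
  qed
  \<comment> \<open>Strictly between \<open>m 0\<close> and \<open>l\<close> there are only
    successors, so a limit below \<open>l\<close> is at most the length of
    \<open>\<tau>\<close>.\<close>
  moreover have "{..<l'} \<subseteq> dom \<tau>" if l': "is_limit l'" "l' < l" for l'
  proof -
    have "l' \<le> m 0"
    proof (rule ccontr)
      assume "\<not> l' \<le> m 0"
      then obtain n where "l' = m n" "n \<noteq> 0"
        using between[of l'] l'(2) by (metis linear order_refl)
      then show False
        using l'(1) not_limit_succ by (cases n) (auto simp: m_Suc)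
    qed
    then show ?thesis
      using dom_s[of 0] by (auto simp: s_0)
  qed
  ultimately show ?thesis
    using that \<sigma>(1) le[of 0] lim dom_\<sigma> \<delta>(1) by (simp add: s_0)
qed

text \<open>The stem of a short Laver tree above some node is appended to that node. From there on
  every finite extension has \<kappa> many successors, and a set of size \<kappa> is
  unbounded.\<close>

lemma PL_splitting_node:
  assumes "T \<in> (PL :: ('k \<rightharpoonup> 'k) set set)"
  shows "\<exists>\<tau>\<in>T. \<forall>xs a. seq_append \<tau> xs \<in> T \<longrightarrow> (\<exists>x\<ge>a. seq_append \<tau> (xs @ [x]) \<in> T)"
proof -
  obtain \<rho> where "\<rho> \<in> T" "short_laver_tree (tree_restrict T \<rho>)"
    using assms unfolding PL_def by blast
  then obtain u where u: "is_stem (tree_restrict T \<rho>) u"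
    "\<And>xs. xs \<in> tree_restrict T \<rho> \<Longrightarrow> prefix u xs \<Longrightarrow>
       |{x. xs @ [x] \<in> tree_restrict T \<rho>}| =o (kappa :: 'k rel)"
    unfolding short_laver_tree_def by blast
  show ?thesis
  proof (intro bexI allI impI)
    show "seq_append \<rho> u \<in> T"
      using u(1) by (simp add: is_stem_def tree_restrict_def)
    fix xs a
    assume "seq_append (seq_append \<rho> u) xs \<in> T"
    then have "\<exists>x\<in>{x. (u @ xs) @ [x] \<in> tree_restrict T \<rho>}. a \<le> x"
      by (intro card_unbounded u(2)) (simp_all add: tree_restrict_def seq_append_append)
    then show "\<exists>x\<ge>a. seq_append (seq_append \<rho> u) (xs @ [x]) \<in> T"
      by (auto simp: tree_restrict_def seq_append_append)
  qed
qed

text \<open>A splitting node has two different one-step extensions, and no single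
  \<open>\<sigma>\<close> extends both.\<close>

lemma PL_not_bounded:
  assumes "T \<in> (PL :: ('k \<rightharpoonup> 'k) set set)"
  shows "\<exists>\<tau>\<in>T. \<not> \<tau> \<subseteq>\<^sub>m \<sigma>"
proof -
  obtain \<tau> where \<tau>: "\<tau> \<in> T"
    "\<And>xs a. seq_append \<tau> xs \<in> T \<Longrightarrow> \<exists>x\<ge>a. seq_append \<tau> (xs @ [x]) \<in> T"
    using PL_splitting_node[OF assms] by blast
  obtain x where x: "seq_append \<tau> [x] \<in> T"
    using \<tau>(2)[of "[]"] \<tau>(1) by auto
  obtain y where y: "seq_append \<tau> [y] \<in> T" "x < y"
    using \<tau>(2)[of "[]" "succ x"] \<tau>(1) less_succ by (auto intro: less_le_trans)
  have "x = y" if "\<tau>(seq_len \<tau> \<mapsto> x) \<subseteq>\<^sub>m \<sigma>" "\<tau>(seq_len \<tau> \<mapsto> y) \<subseteq>\<^sub>m \<sigma>"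
    using that[THEN map_le_same, of "seq_len \<tau>"] by simp
  then show ?thesis
    using x y by auto
qed

text \<open>Let \<open>t\<close> in \<open>D\<close> extend what a splitting node decodes. The
  points of colour \<open>t\<close> being stationary, some \<omega>-branch above that node has a
  limit value of colour \<open>t\<close>, and this proposal is accepted.\<close>

lemma decode_dense:
  assumes col: "\<And>\<delta>. col \<delta> \<in> kseqs" "\<And>t. t \<in> kseqs \<Longrightarrow> omega_stationary {\<delta>. col \<delta> = t}"
    and T: "T \<in> (PL :: ('k \<rightharpoonup> 'k) set set)" and D: "cohen_dense D"
  shows "\<exists>\<sigma>\<in>T. \<exists>t\<in>D. t \<subseteq>\<^sub>m decode col \<sigma>"
proof -
  have tree: "is_tree T" "limit_closed T"
    using T by (auto simp: PL_def)
  obtain \<tau> where \<tau>: "\<tau> \<in> T"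
    "\<And>xs a. seq_append \<tau> xs \<in> T \<Longrightarrow> \<exists>x\<ge>a. seq_append \<tau> (xs @ [x]) \<in> T"
    using PL_splitting_node[OF T] by blast
  have "decode col \<tau> \<in> kseqs"
    using \<tau>(1) tree(1) col(1) by (intro decode_kseqs) (auto simp: is_tree_def)
  then obtain t where t: "t \<in> D" "t \<in> kseqs" "decode col \<tau> \<subseteq>\<^sub>m t"
    using D unfolding cohen_dense_def by blast
  obtain \<sigma> l where \<sigma>: "\<sigma> \<in> T" "\<tau> \<subseteq>\<^sub>m \<sigma>" "is_limit l" "dom \<sigma> = {..<l}"
    "lim_val \<sigma> l \<in> {\<delta>. col \<delta> = t}" "\<And>l'. is_limit l' \<Longrightarrow> l' < l \<Longrightarrow> {..<l'} \<subseteq> dom \<tau>"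
    using omega_branch[OF tree \<tau> col(2)[OF t(2)]] by metis
  have "t \<subseteq>\<^sub>m decode col \<sigma>"
    using decode_accept[OF \<sigma>(2-4,6), of col] \<sigma>(5) t(3) by simp
  then show ?thesis
    using \<sigma>(1) t(1) by blast
qed

end

section \<open>The forcing relation\<close>

lemma dense_below_mono: "dense_below P p D \<Longrightarrow> q \<le> p \<Longrightarrow> dense_below P q D"
  unfolding dense_below_def using order_trans by blast

lemma dense_belowD: "dense_below P p D \<Longrightarrow> p \<in> P \<Longrightarrow> \<exists>q\<in>P. q \<le> p \<and> q \<in> D"
  unfolding dense_below_def by blast

lemma dense_belowI: "(\<And>q. q \<in> P \<Longrightarrow> q \<le> p \<Longrightarrow> q \<in> D) \<Longrightarrow> dense_below P p D"
  unfolding dense_below_def by blast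

lemma forces_eq_refl: "forces_eq P x x p"
proof (induction x arbitrary: p rule: wf_induct_rule[OF wf_pairs])
  case (1 x)
  have "forces_eq P x' x' q" if "(x', s) \<in> pairs x" for x' s q
    using 1 that by blast
  then show ?case
    by (subst forces_eq.simps) (blast intro: dense_belowI)
qed

text \<open>Both clauses defining \<open>forces_eq\<close> recurse with a member of \<open>x\<close>
  on the left, so the induction is on \<open>x\<close> with \<open>y\<close> arbitrary; swapping the
  names exchanges the clauses.\<close>

lemma forces_eq_sym: "forces_eq P x y p \<Longrightarrow> forces_eq P y x p"
proof (induction x arbitrary: y p rule: wf_induct_rule[OF wf_pairs])
  case (1 x)
  have IH: "forces_eq P x' y' q \<Longrightarrow> forces_eq P y' x' q" if "(x', s) \<in> pairs x" for x' s y' q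
    using 1(1) that by blast
  have "dense_below P p {q. q \<le> s \<longrightarrow> (\<exists>(y', t) \<in> pairs y. q \<le> t \<and> forces_eq P y' x' q)}"
    if "(x', s) \<in> pairs x" for x' s
  proof -
    have "dense_below P p {q. q \<le> s \<longrightarrow> (\<exists>(y', t) \<in> pairs y. q \<le> t \<and> forces_eq P x' y' q)}"
      using 1(2) that by (subst (asm) forces_eq.simps) blast
    then show ?thesis
      unfolding dense_below_def using IH[OF that] by fastforce
  qed
  moreover have "dense_below P p {q. q \<le> t \<longrightarrow> (\<exists>(x', s) \<in> pairs x. q \<le> s \<and> forces_eq P y' x' q)}"
    if "(y', t) \<in> pairs y" for y' t
  proof -
    have "dense_below P p {q. q \<le> t \<longrightarrow> (\<exists>(x', s) \<in> pairs x. q \<le> s \<and> forces_eq P x' y' q)}"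
      using 1(2) that by (subst (asm) forces_eq.simps) blast
    then show ?thesis
      unfolding dense_below_def using IH by fastforce
  qed
  ultimately show ?case
    by (subst forces_eq.simps) blast
qed

lemma forces_eq_mono: "forces_eq P x y p \<Longrightarrow> q \<le> p \<Longrightarrow> forces_eq P x y q"
  by (subst (asm) forces_eq.simps, subst forces_eq.simps) (auto intro: dense_below_mono)

lemma forces_eq_pairsD:
  assumes "forces_eq P x y p" "(x', s) \<in> pairs x" "p \<in> P" "p \<le> s"
  shows "\<exists>q\<in>P. q \<le> p \<and> (\<exists>(y', t) \<in> pairs y. q \<le> t \<and> forces_eq P x' y' q)"
proof -
  have "dense_below P p {q. q \<le> s \<longrightarrow> (\<exists>(y', t) \<in> pairs y. q \<le> t \<and> forces_eq P x' y' q)}"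
    using assms(1,2) by (subst (asm) forces_eq.simps) blast
  from dense_belowD[OF this assms(3)] obtain q
    where "q \<in> P" "q \<le> p" "q \<le> s \<longrightarrow> (\<exists>(y', t) \<in> pairs y. q \<le> t \<and> forces_eq P x' y' q)"
    by blast
  then show ?thesis
    using assms(4) order_trans by blast
qed

lemma forces_eqI:
  assumes "\<And>x' s q. (x', s) \<in> pairs x \<Longrightarrow> q \<in> P \<Longrightarrow> q \<le> p \<Longrightarrow> q \<le> s \<Longrightarrow>
      \<exists>r\<in>P. r \<le> q \<and> (\<exists>(y', t) \<in> pairs y. r \<le> t \<and> forces_eq P x' y' r)"
    and "\<And>y' t q. (y', t) \<in> pairs y \<Longrightarrow> q \<in> P \<Longrightarrow> q \<le> p \<Longrightarrow> q \<le> t \<Longrightarrow>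
      \<exists>r\<in>P. r \<le> q \<and> (\<exists>(x', s) \<in> pairs x. r \<le> s \<and> forces_eq P x' y' r)"
  shows "forces_eq P x y p"
proof -
  have "dense_below P p {q. q \<le> s \<longrightarrow> (\<exists>(y', t) \<in> pairs y. q \<le> t \<and> forces_eq P x' y' q)}"
    if "(x', s) \<in> pairs x" for x' s
    unfolding dense_below_def
  proof (intro ballI impI)
    fix q assume q: "q \<in> P" "q \<le> p"
    show "\<exists>r\<in>P. r \<le> q \<and> r \<in> {q. q \<le> s \<longrightarrow> (\<exists>(y', t) \<in> pairs y. q \<le> t \<and> forces_eq P x' y' q)}"
    proof (cases "q \<le> s")
      case True
      then show ?thesis
        using assms(1)[OF that q True] by blast
    qed (use q in blast)
  qed
  moreover have "dense_below P p {q. q \<le> t \<longrightarrow> (\<exists>(x', s) \<in> pairs x. q \<le> s \<and> forces_eq P x' y' q)}"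
    if "(y', t) \<in> pairs y" for y' t
    unfolding dense_below_def
  proof (intro ballI impI)
    fix q assume q: "q \<in> P" "q \<le> p"
    show "\<exists>r\<in>P. r \<le> q \<and> r \<in> {q. q \<le> t \<longrightarrow> (\<exists>(x', s) \<in> pairs x. q \<le> s \<and> forces_eq P x' y' q)}"
    proof (cases "q \<le> t")
      case True
      then show ?thesis
        using assms(2)[OF that q True] by blast
    qed (use q in blast)
  qed
  ultimately show ?thesis
    by (subst forces_eq.simps) blast
qed

text \<open>A member of \<open>x\<close> is matched first in \<open>y\<close>, then in
  \<open>z\<close>, strengthening the condition each time; the other clause goes the opposite way by
  symmetry. The induction hypothesis is always applied to a member of \<open>x\<close>.\<close>

lemma forces_eq_trans: "forces_eq P x y p \<Longrightarrow> forces_eq P y z p \<Longrightarrow> forces_eq P x z p"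
proof (induction x arbitrary: y z p rule: wf_induct_rule[OF wf_pairs])
  case (1 x)
  have IH: "forces_eq P x' y' q \<Longrightarrow> forces_eq P y' z' q \<Longrightarrow> forces_eq P x' z' q"
    if "(x', s) \<in> pairs x" for x' s y' z' q
    using 1(1) that by blast
  show ?case
  proof (rule forces_eqI)
    fix x' s q
    assume x': "(x', s) \<in> pairs x" and q: "q \<in> P" "q \<le> p" "q \<le> s"
    obtain r y' t where r: "r \<in> P" "r \<le> q" "(y', t) \<in> pairs y" "r \<le> t" "forces_eq P x' y' r"
      using forces_eq_pairsD[OF forces_eq_mono[OF 1(2) q(2)] x' q(1,3)] by blast
    have "forces_eq P y z r"
      using forces_eq_mono[OF 1(3)] r(2) q(2) order_trans by blast
    from forces_eq_pairsD[OF this r(3,1,4)] obtain r' z' u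
      where r': "r' \<in> P" "r' \<le> r" "(z', u) \<in> pairs z" "r' \<le> u" "forces_eq P y' z' r'"
      by blast
    have "forces_eq P x' z' r'"
      using IH[OF x' forces_eq_mono[OF r(5) r'(2)] r'(5)] .
    then show "\<exists>r\<in>P. r \<le> q \<and> (\<exists>(z', u) \<in> pairs z. r \<le> u \<and> forces_eq P x' z' r)"
      using r' r(2) order_trans by blast
  next
    fix z' u q
    assume z': "(z', u) \<in> pairs z" and q: "q \<in> P" "q \<le> p" "q \<le> u"
    obtain r y' t where r: "r \<in> P" "r \<le> q" "(y', t) \<in> pairs y" "r \<le> t" "forces_eq P z' y' r"
      using forces_eq_pairsD[OF forces_eq_sym[OF forces_eq_mono[OF 1(3) q(2)]] z' q(1,3)] by blast
    have "forces_eq P y x r"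
      using forces_eq_sym[OF forces_eq_mono[OF 1(2)]] r(2) q(2) order_trans by blast
    from forces_eq_pairsD[OF this r(3,1,4)] obtain r' x' s
      where r': "r' \<in> P" "r' \<le> r" "(x', s) \<in> pairs x" "r' \<le> s" "forces_eq P y' x' r'"
      by blast
    have "forces_eq P x' z' r'"
      using IH[OF r'(3) forces_eq_sym[OF r'(5)] forces_eq_sym[OF forces_eq_mono[OF r(5) r'(2)]]] .
    then show "\<exists>r\<in>P. r \<le> q \<and> (\<exists>(x', s) \<in> pairs x. r \<le> s \<and> forces_eq P x' z' r)"
      using r' r(2) order_trans by blast
  qed
qed

section \<open>Monotonicity and introduction rules for formulas\<close>

lemma forces_mem_mono: "forces_mem P x y p \<Longrightarrow> q \<le> p \<Longrightarrow> forces_mem P x y q"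
  unfolding forces_mem_def by (rule dense_below_mono)

lemma forces_mono: "forces P \<phi> p \<Longrightarrow> q \<le> p \<Longrightarrow> forces P \<phi> q"
proof (induction \<phi>)
  case (FMem x y)
  then show ?case
    unfolding forces.simps by (rule forces_mem_mono)
next
  case (FEq x y)
  then show ?case
    unfolding forces.simps by (rule forces_eq_mono)
next
  case (FNeg \<phi>)
  show ?case
    unfolding forces.simps
  proof (intro ballI impI)
    fix r assume "r \<in> P" "r \<le> q"
    then show "\<not> forces P \<phi> r"
      using FNeg.prems order_trans[of r q p] by simp
  qed
next
  case (FEx \<phi>)
  show ?case
    using FEx.prems unfolding forces.simps by (rule dense_below_mono)
qed simp

lemma forces_memI:
  assumes "(y', t) \<in> pairs y" "p \<le> t" "forces_eq P y' x p"
  shows "forces_mem P x y p"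
  unfolding forces_mem_def
proof (rule dense_belowI)
  fix q assume "q \<le> p"
  then have "q \<le> t" "forces_eq P y' x q"
    using assms(2) order_trans[of q p t] forces_eq_mono[OF assms(3)] by simp_all
  then show "q \<in> {q. \<exists>(y', t) \<in> pairs y. q \<le> t \<and> forces_eq P y' x q}"
    using assms(1) by blast
qed

lemma forces_memD:
  assumes "forces_mem P x y p" "p \<in> P"
  shows "\<exists>q\<in>P. q \<le> p \<and> (\<exists>(y', t) \<in> pairs y. q \<le> t \<and> forces_eq P y' x q)"
  using dense_belowD[OF assms[unfolded forces_mem_def]] by blast

text \<open>\<open>FImp\<close> is coded by negation and conjunction, so one extension
  \<open>r\<close> forcing \<open>\<psi>\<close> already refutes that \<open>q\<close> forces the
  negation of \<open>\<psi>\<close>.\<close>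

lemma forces_FImpI:
  assumes "\<And>q. q \<in> P \<Longrightarrow> q \<le> p \<Longrightarrow> forces P \<phi> q \<Longrightarrow> \<exists>r\<in>P. r \<le> q \<and> forces P \<psi> r"
  shows "forces P (FImp \<phi> \<psi>) p"
  using assms unfolding FImp_def by auto

text \<open>The negations in \<open>FAll\<close> and \<open>FImp\<close> leave room to strengthen
  \<open>q\<close> before the instance has to be forced.\<close>

lemma forces_FBallI:
  assumes "\<And>x q. x \<in> names P \<Longrightarrow> q \<in> P \<Longrightarrow> q \<le> p \<Longrightarrow> forces_mem P x A q \<Longrightarrow>
      \<exists>r\<in>P. r \<le> q \<and> forces P (\<phi> x) r"
  shows "forces P (FBall A \<phi>) p"
proof -
  have "forces P (FImp (FMem x A) (\<phi> x)) q" if "x \<in> names P" "q \<le> p" for x q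
    using that assms order_trans by (intro forces_FImpI) fastforce
  note FImp = this
  show ?thesis
    unfolding FBall_def FAll_def forces.simps
  proof (intro ballI impI notI)
    fix q assume q: "q \<in> P" "q \<le> p"
      and "dense_below P q {q. \<exists>x\<in>names P. \<forall>r\<in>P. r \<le> q \<longrightarrow> \<not> forces P (FImp (FMem x A) (\<phi> x)) r}"
    from dense_belowD[OF this(3) q(1)] obtain r x where
      r: "r \<in> P" "r \<le> q" "x \<in> names P" "\<not> forces P (FImp (FMem x A) (\<phi> x)) r"
      by blast
    then show False
      using FImp q(2) order_trans by blast
  qed
qed

lemma forces_FBexI:
  assumes "x \<in> names P" "forces_mem P x A p" "forces P (\<phi> x) p"
  shows "forces P (FBex A \<phi>) p"
  unfolding FBex_def forces.simps
proof (rule dense_belowI)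
  fix q assume "q \<le> p"
  then have "forces_mem P x A q" "forces P (\<phi> x) q"
    using forces_mem_mono[OF assms(2)] forces_mono[OF assms(3)] by simp_all
  then show "q \<in> {q. \<exists>x\<in>names P. forces_mem P x A q \<and> forces P (\<phi> x) q}"
    using assms(1) by blast
qed

section \<open>Canonical names\<close>

text \<open>The bound is the number of subsets of \<kappa>. It is chosen to cover both the set of
  conditions and the family of all dense sets of binary sequences.\<close>

definition small :: "'k itself \<Rightarrow> 'a set \<Rightarrow> bool" where
  "small _ X \<longleftrightarrow> |X| \<le>o |UNIV :: 'k set set|"

text \<open>Size conditions that make canonical names meaningful: \<open>set_name\<close> chooses a
  family with a given range, and such a family exists only if the index type is large
  enough.\<close>

locale forcing_names =
  fixes P :: "'p::order set" and k :: "'k::wellorder itself" and i :: "'i itself"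
  assumes ex_above: "\<exists>b. a < (b :: 'k)"
    and P_small: "small k P"
    and kseqs_small: "|kseqs :: ('k \<rightharpoonup> bool) set| \<le>o |UNIV :: 'k set|"
    and index_large: "|UNIV :: 'k set set| \<le>o |UNIV :: 'i set|"
begin

abbreviation set_n :: "('i, 'p) name set \<Rightarrow> ('i, 'p) name" where "set_n \<equiv> set_name P"
abbreviation pair_n :: "('i, 'p) name \<Rightarrow> ('i, 'p) name \<Rightarrow> ('i, 'p) name" where
  "pair_n \<equiv> pair_name P"
abbreviation ord_n :: "'k \<Rightarrow> ('i, 'p) name" where "ord_n \<equiv> ord_name P"
abbreviation bit_n :: "bool \<Rightarrow> ('i, 'p) name" where "bit_n \<equiv> bit_name P"

section \<open>Small sets and the names made from them\<close>

lemma infinite_k: "infinite (UNIV :: 'k set)"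
  by (rule infinite_growing) (simp_all add: ex_above)

lemma infinite_Pow_k: "infinite (UNIV :: 'k set set)"
  using infinite_k finite_Pow_iff[of "UNIV :: 'k set"] by simp

lemma small_mono: "small k Y \<Longrightarrow> X \<subseteq> Y \<Longrightarrow> small k X"
  unfolding small_def using card_of_mono1 ordLeq_transitive by blast

lemma small_image: "small k X \<Longrightarrow> small k (f ` X)"
  unfolding small_def using card_of_image ordLeq_transitive by blast

lemma small_Times: "small k X \<Longrightarrow> small k Y \<Longrightarrow> small k (X \<times> Y)"
  unfolding small_def
  by (rule card_of_Times_ordLeq_infinite_Field[OF _ _ _ card_of_Card_order])
    (simp_all only: Field_card_of infinite_Pow_k not_False_eq_True)

lemma small_if_card_le_k: "|X| \<le>o |UNIV :: 'k set| \<Longrightarrow> small k X"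
  unfolding small_def using card_of_Pow[of "UNIV :: 'k set"] ordLess_imp_ordLeq ordLeq_transitive by fastforce

lemma small_k: "small k (X :: 'k set)"
  by (rule small_if_card_le_k) (simp add: card_of_mono1)

lemma small_finite: "finite X \<Longrightarrow> small k X"
  unfolding small_def using infinite_Pow_k
  by (meson card_of_ordLeq_finite card_of_Well_order ordLeq_total)

lemma ran_index_exists:
  assumes "small k X"
  shows "\<exists>f :: 'i \<rightharpoonup> 'x. ran f = X"
proof (cases "X = {}")
  case False
  have "|X| \<le>o |UNIV :: 'i set|"
    using assms index_large unfolding small_def using ordLeq_transitive by blast
  then obtain g :: "'i \<Rightarrow> 'x" where "g ` UNIV = X"
    unfolding card_of_ordLeq2[OF False, symmetric] by blast
  then have "ran (\<lambda>i. Some (g i)) = X"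
    by (auto simp: ran_def)
  then show ?thesis
    by blast
next
  case True
  then show ?thesis
    by (intro exI[of _ Map.empty]) simp
qed

lemma pairs_SOME: "small k X \<Longrightarrow> pairs (Name (SOME f. ran f = X) :: ('i, 'p) name) = X"
  using someI_ex[OF ran_index_exists] by simp

lemma pairs_set_name: "small k X \<Longrightarrow> pairs (set_n X) = X \<times> P"
  unfolding set_name_def by (intro pairs_SOME small_Times P_small)

lemma set_name_in_names: "small k X \<Longrightarrow> X \<subseteq> names P \<Longrightarrow> set_n X \<in> names P"
  by (rule names.intros) (auto simp: pairs_set_name)

text \<open>The condition \<open>p\<close> guarantees that \<open>P\<close> is nonempty; otherwise
  \<open>X \<times> P\<close> would be empty for every \<open>X\<close>.\<close>

lemma set_name_inject: "small k X \<Longrightarrow> small k Y \<Longrightarrow> p \<in> P \<Longrightarrow> set_n X = set_n Y \<longleftrightarrow> X = Y"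
  by (metis pairs_set_name times_eq_iff empty_iff)

lemma forces_mem_set_nameI: "small k X \<Longrightarrow> x \<in> X \<Longrightarrow> p \<in> P \<Longrightarrow> forces_mem P x (set_n X) p"
  by (rule forces_memI[of x p]) (simp_all add: pairs_set_name forces_eq_refl)

lemma forces_mem_set_nameD:
  "small k X \<Longrightarrow> forces_mem P x (set_n X) p \<Longrightarrow> p \<in> P \<Longrightarrow> \<exists>q\<in>P. q \<le> p \<and> (\<exists>y\<in>X. forces_eq P y x q)"
  using forces_memD[of P x "set_n X" p] by (auto simp: pairs_set_name)

lemma forces_eq_set_nameI:
  assumes "small k X" "small k Y" "\<forall>x\<in>X. \<exists>y\<in>Y. forces_eq P x y p" "\<forall>y\<in>Y. \<exists>x\<in>X. forces_eq P x y p"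
  shows "forces_eq P (set_n X) (set_n Y) p"
proof (rule forces_eqI)
  fix x s q assume "(x, s) \<in> pairs (set_n X)" and q: "q \<in> P" "q \<le> p"
  then obtain y where "y \<in> Y" "forces_eq P x y q"
    using assms(1,3) forces_eq_mono by (fastforce simp: pairs_set_name)
  then show "\<exists>r\<in>P. r \<le> q \<and> (\<exists>(y, t) \<in> pairs (set_n Y). r \<le> t \<and> forces_eq P x y r)"
    using q assms(2) by (auto simp: pairs_set_name intro!: bexI[of _ q])
next
  fix y t q assume "(y, t) \<in> pairs (set_n Y)" and q: "q \<in> P" "q \<le> p"
  then obtain x where "x \<in> X" "forces_eq P x y q"
    using assms(2,4) forces_eq_mono by (fastforce simp: pairs_set_name)
  then show "\<exists>r\<in>P. r \<le> q \<and> (\<exists>(x, s) \<in> pairs (set_n X). r \<le> s \<and> forces_eq P x y r)"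
    using q assms(1) by (auto simp: pairs_set_name intro!: bexI[of _ q])
qed

text \<open>Separation passes from members to sets: some condition forces a given member of
  \<open>X\<close> to equal a member of \<open>Y\<close>, and by \<open>sep\<close> the two
  coincide.\<close>

lemma forces_eq_set_nameD:
  assumes "forces_eq P (set_n X) (set_n Y) p" "small k X" "small k Y" "p \<in> P"
    and sep: "\<And>x y q. x \<in> X \<Longrightarrow> y \<in> Y \<Longrightarrow> q \<in> P \<Longrightarrow> forces_eq P x y q \<Longrightarrow> x = y"
  shows "X = Y"
proof
  show "X \<subseteq> Y"
  proof
    fix x assume "x \<in> X"
    then obtain q y where "q \<in> P" "y \<in> Y" "forces_eq P x y q"
      using forces_eq_pairsD[OF assms(1), of x p] assms by (auto simp: pairs_set_name)
    then show "x \<in> Y"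
      using sep \<open>x \<in> X\<close> by blast
  qed
  show "Y \<subseteq> X"
  proof
    fix y assume "y \<in> Y"
    then obtain q x where "q \<in> P" "x \<in> X" "forces_eq P y x q"
      using forces_eq_pairsD[OF forces_eq_sym[OF assms(1)], of y p] assms
      by (auto simp: pairs_set_name)
    then show "y \<in> X"
      using sep \<open>y \<in> Y\<close> forces_eq_sym by blast
  qed
qed

text \<open>By induction the names of the members are separated, so both sets of names are equal. If
  \<open>a < b\<close>, then \<open>ord_n a\<close> would also be the name of some
  \<open>a' < a\<close>, against the induction hypothesis at \<open>a'\<close>; the case
  \<open>b < a\<close> is alike.\<close>

lemma forces_eq_ord_nameD:
  "forces_eq P (ord_n a) (ord_n b) p \<Longrightarrow> p \<in> P \<Longrightarrow> a = b"
proof (induction a arbitrary: b p rule: less_induct)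
  case (less a)
  have "ord_n ` {..<a} = ord_n ` {..<b}"
  proof (rule forces_eq_set_nameD)
    show "forces_eq P (set_n (ord_n ` {..<a})) (set_n (ord_n ` {..<b})) p"
      using less.prems(1) by (simp add: ord_name.simps[of P a] ord_name.simps[of P b])
    show "x = y" if "x \<in> ord_n ` {..<a}" "y \<in> ord_n ` {..<b}" "q \<in> P" "forces_eq P x y q" for x y q
      using that less.IH by auto
  qed (use less.prems(2) in \<open>auto intro: small_image small_k\<close>)
  show ?case
  proof (cases a b rule: linorder_cases)
    case less
    then obtain a' where "a' < a" "ord_n a' = ord_n a"
      using \<open>ord_n ` {..<a} = ord_n ` {..<b}\<close> by (metis (no_types, lifting) image_iff lessThan_iff)
    then show ?thesis
      using less.IH[of a' a p] less.prems(2) forces_eq_refl by (metis less_irrefl)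
  next
    case greater
    then obtain b' where "b' < b" "ord_n b' = ord_n b"
      using \<open>ord_n ` {..<a} = ord_n ` {..<b}\<close> by (metis (no_types, lifting) image_iff lessThan_iff)
    then show ?thesis
      using less.IH[of b b' p] greater less.prems(2) forces_eq_refl by (metis less_irrefl)
  qed
qed

text \<open>The bits are the ordinals 0 and 1, here \<open>z\<close> and \<open>u\<close>, so the
  separation of ordinal names also serves for bits.\<close>

lemma bit_name_ord:
  obtains e :: "bool \<Rightarrow> 'k" where "inj e" "\<And>b. bit_n b = ord_n (e b)"
proof -
  define z where "z = (LEAST a :: 'k. True)"
  define u where "u = (LEAST a. z < a)"
  have z: "z \<le> a" for a
    unfolding z_def by (rule Least_le) simp
  have "z < u"
    unfolding u_def using ex_above by (rule LeastI_ex)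
  have u: "a < u \<longleftrightarrow> a = z" for a
    using not_less_Least[of a "\<lambda>a. z < a"] z[of a] \<open>z < u\<close> unfolding u_def[symmetric] by auto
  have "{..<z} = {}"
    using z by (auto simp: not_less[symmetric])
  then have 0: "ord_n z = set_n {}"
    by (simp add: ord_name.simps[of P z])
  have "{..<u} = {z}"
    using u by auto
  then have "ord_n u = set_n {set_n {}}"
    by (simp add: ord_name.simps[of P u] 0)
  with 0 \<open>z < u\<close> show ?thesis
    by (intro that[of "\<lambda>b. if b then u else z"]) (auto simp: inj_def bit_name_def)
qed

text \<open>A Kuratowski pair of ordinals is a set of finite sets of ordinals, so separation is
  lifted twice, and then the pairs are compared in the ground model.\<close>

lemma forces_eq_pair_nameD:
  assumes eq: "forces_eq P (pair_n (ord_n a) (ord_n b)) (pair_n (ord_n a') (ord_n b')) p"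
    and p: "p \<in> P"
  shows "a = a' \<and> b = b'"
proof -
  define F where "F = (\<lambda>A. set_n (ord_n ` A))"
  have F: "F A = F B" if "finite A" "finite B" "q \<in> P" "forces_eq P (F A) (F B) q" for A B q
  proof -
    have "ord_n ` A = ord_n ` B"
    proof (rule forces_eq_set_nameD[OF that(4)[unfolded F_def] _ _ that(3)])
      show "x = y" if "x \<in> ord_n ` A" "y \<in> ord_n ` B" "r \<in> P" "forces_eq P x y r" for x y r
        using that forces_eq_ord_nameD by auto
    qed (use that(1,2) in \<open>auto intro: small_finite\<close>)
    then show ?thesis
      by (simp add: F_def)
  qed
  have "F ` {{a}, {a, b}} = F ` {{a'}, {a', b'}}"
  proof (rule forces_eq_set_nameD[OF _ _ _ p])
    show "forces_eq P (set_n (F ` {{a}, {a, b}})) (set_n (F ` {{a'}, {a', b'}})) p"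
      using eq by (simp add: pair_name_def F_def)
    show "x = y" if *: "x \<in> F ` {{a}, {a, b}}" "y \<in> F ` {{a'}, {a', b'}}" "q \<in> P" "forces_eq P x y q"
      for x y q
    proof -
      obtain A B where "x = F A" "y = F B" "finite A" "finite B"
        using *(1,2) by auto
      then show ?thesis
        using F[of A B q] *(3,4) by simp
    qed
  qed (simp_all add: small_finite)
  \<comment> \<open>This turns the equality of sets of names into an equality of sets of sets of
    ordinals.\<close>
  moreover have "inj_on F {A. finite A}"
  proof (rule inj_onI)
    have inj: "inj ord_n"
    proof (rule injI)
      fix a b assume "ord_n a = ord_n b"
      then show "a = b"
        using forces_eq_ord_nameD[of a b p] forces_eq_refl[of P "ord_n a" p] p by simp
    qed
    fix A B :: "'k set"
    assume "A \<in> {A. finite A}" "B \<in> {A. finite A}" "F A = F B"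
    then have "ord_n ` A = ord_n ` B"
      using set_name_inject[OF small_finite small_finite p] by (simp add: F_def)
    then show "A = B"
      using inj by (simp add: inj_image_eq_iff)
  qed
  ultimately have "{{a}, {a, b}} = {{a'}, {a', b'}}"
    using inj_on_image_eq_iff[of F "{A. finite A}" "{{a}, {a, b}}" "{{a'}, {a', b'}}"] by simp
  then show ?thesis
    by (auto simp: doubleton_eq_iff)
qed

lemma forces_eq_pair_nameI:
  assumes "forces_eq P x x' p" "forces_eq P y y' p"
  shows "forces_eq P (pair_n x y) (pair_n x' y') p"
proof -
  have "forces_eq P (set_n {x}) (set_n {x'}) p" "forces_eq P (set_n {x, y}) (set_n {x', y'}) p"
    by (intro forces_eq_set_nameI small_finite; use assms in simp)+
  then show ?thesis
    unfolding pair_name_def by (intro forces_eq_set_nameI small_finite) simp_all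
qed

lemma ord_name_in_names: "ord_n a \<in> names P"
proof (induction a rule: less_induct)
  case (less a)
  then have "ord_n ` {..<a} \<subseteq> names P"
    by blast
  then show ?case
    unfolding ord_name.simps[of P a] by (intro set_name_in_names small_image small_k)
qed

lemma bit_name_in_names: "bit_n b \<in> names P"
  by (rule bit_name_ord) (simp add: ord_name_in_names)

lemma pair_name_in_names: "x \<in> names P \<Longrightarrow> y \<in> names P \<Longrightarrow> pair_n x y \<in> names P"
  unfolding pair_name_def by (auto intro!: set_name_in_names small_finite)

lemma small_seq_graph: "small k {pair_n (ord_n a) (bit_n b) | a b. R a b}"
proof -
  have "small k ((\<lambda>(a, b). pair_n (ord_n a) (bit_n b)) ` (UNIV :: ('k \<times> bool) set))"
    unfolding UNIV_Times_UNIV[symmetric] by (intro small_image small_Times small_k small_finite) simp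
  then show ?thesis
    by (rule small_mono) auto
qed

lemma seq_name_in_names: "seq_name P (s :: 'k \<rightharpoonup> bool) \<in> (names P :: ('i, 'p) name set)"
  unfolding seq_name_def
  by (intro set_name_in_names small_seq_graph)
    (auto intro: pair_name_in_names ord_name_in_names bit_name_in_names)

end

section \<open>A generic sequence decided densely\<close>

lemma card_of_Pow_mono_ordLeq: "|A| \<le>o |B| \<Longrightarrow> |Pow A| \<le>o |Pow B|"
proof -
  assume "|A| \<le>o |B|"
  then obtain f where "inj_on f A" "f ` A \<subseteq> B"
    unfolding card_of_ordLeq[symmetric] by blast
  then have "inj_on ((`) f) (Pow A)" "(`) f ` Pow A \<subseteq> Pow B"
    by (auto intro: inj_on_image_Pow)
  then show ?thesis
    unfolding card_of_ordLeq[symmetric] by blast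
qed

text \<open>Meeting these dense sets makes the generic function total.\<close>

lemma cohen_dense_dom:
  fixes a :: "'k::wellorder"
  assumes "\<exists>c. a < c"
  shows "cohen_dense {t. t \<in> kseqs \<and> a \<in> dom (t :: 'k \<rightharpoonup> bool)}"
  unfolding cohen_dense_def
proof (intro conjI ballI)
  fix s :: "'k \<rightharpoonup> bool" assume "s \<in> kseqs"
  then obtain b where b: "dom s = {..<b}"
    by (auto simp: kseqs_def)
  obtain c where "a < c"
    using assms by blast
  \<comment> \<open>The values of \<open>s\<close> are kept, and positions outside its domain get
    \<open>False\<close>.\<close>
  define t where "t = (\<lambda>x. if x < max b c then Some (s x = Some True) else None)"
  have "dom t = {..<max b c}"
    by (auto simp: t_def dom_def)
  then have "t \<in> kseqs" "a \<in> dom t"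
    using \<open>a < c\<close> by (auto simp: kseqs_def less_max_iff_disj)
  moreover have "s \<subseteq>\<^sub>m t"
    unfolding map_le_def
  proof
    fix x assume x: "x \<in> dom s"
    then have "x < max b c"
      using b by (simp add: less_max_iff_disj)
    moreover obtain y where "s x = Some y"
      using x by blast
    ultimately show "s x = t x"
      by (simp add: t_def)
  qed
  ultimately show "\<exists>t\<in>{t. t \<in> kseqs \<and> a \<in> dom t}. s \<subseteq>\<^sub>m t"
    by blast
qed auto

context forcing_names
begin

text \<open>\<open>dec p a b\<close> is read: condition \<open>p\<close> decides bit
  \<open>a\<close> to be \<open>b\<close>. A generic filter evaluates the name to the set of all
  bits decided by its members.\<close>

definition decided_name :: "('p \<Rightarrow> 'k \<Rightarrow> bool \<Rightarrow> bool) \<Rightarrow> ('i, 'p) name" where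
  "decided_name dec =
     Name (SOME f. ran f = {(pair_n (ord_n a) (bit_n b), p) | a b p. p \<in> P \<and> dec p a b})"

lemma pairs_decided_name:
  "pairs (decided_name dec) = {(pair_n (ord_n a) (bit_n b), p) | a b p. p \<in> P \<and> dec p a b}"
  unfolding decided_name_def
proof (rule pairs_SOME)
  show "small k {(pair_n (ord_n a) (bit_n b), p) | a b p. p \<in> P \<and> dec p a b}"
    by (rule small_mono[OF small_Times[OF small_seq_graph[of "\<lambda>_ _. True"] P_small]]) auto
qed

lemma decided_name_in_names: "decided_name dec \<in> names P"
  by (rule names.intros)
    (auto simp: pairs_decided_name intro: pair_name_in_names ord_name_in_names bit_name_in_names)

lemma forces_mem_decidedI:
  assumes "p \<in> P" "dec p a b" "q \<le> p" "forces_eq P (pair_n (ord_n a) (bit_n b)) z q"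
  shows "forces_mem P z (decided_name dec) q"
  by (rule forces_memI[OF _ assms(3,4)]) (use assms(1,2) in \<open>auto simp: pairs_decided_name\<close>)

lemma forces_mem_decidedD:
  assumes "forces_mem P z (decided_name dec) q" "q \<in> P"
  obtains r a b p where "r \<in> P" "r \<le> q" "p \<in> P" "r \<le> p" "dec p a b"
    "forces_eq P (pair_n (ord_n a) (bit_n b)) z r"
  using forces_memD[OF assms] that by (auto simp: pairs_decided_name)

lemma forces_eq_pair_bit_nameD:
  assumes "forces_eq P (pair_n (ord_n a) (bit_n b)) (pair_n (ord_n a') (bit_n b')) p" "p \<in> P"
  shows "a = a' \<and> b = b'"
proof -
  obtain e :: "bool \<Rightarrow> 'k" where e: "inj e" "\<And>b. bit_n b = ord_n (e b)"
    by (rule bit_name_ord) blast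
  then have "a = a' \<and> e b = e b'"
    using forces_eq_pair_nameD[of a "e b" a' "e b'" p] assms by simp
  then show ?thesis
    using e(1) by (simp add: inj_eq)
qed

lemma small_bits: "small k (range bit_n)"
  by (intro small_finite) simp

text \<open>\<open>unique\<close> makes the decided bits single-valued, as two conditions in a
  generic filter have a common extension; \<open>total\<close> is the density that gives every
  position a bit.\<close>

lemma forces_function:
  fixes dec :: "'p \<Rightarrow> 'k \<Rightarrow> bool \<Rightarrow> bool"
  assumes unique: "\<And>p q r a b b'. p \<in> P \<Longrightarrow> q \<in> P \<Longrightarrow> r \<in> P \<Longrightarrow> r \<le> p \<Longrightarrow> r \<le> q \<Longrightarrow>
      dec p a b \<Longrightarrow> dec q a b' \<Longrightarrow> b = b'"
    and total: "\<And>p a. p \<in> P \<Longrightarrow> \<exists>q\<in>P. q \<le> p \<and> (\<exists>b. dec q a b)"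
  shows "forces P (function_fm P (decided_name dec) (kappa_name P TYPE('k)) (two_name P)) p"
proof -
  let ?c = "decided_name dec" and ?K = "kappa_name P TYPE('k) :: ('i, 'p) name"
    and ?B = "two_name P :: ('i, 'p) name"
  have K: "forces_mem P (ord_n a) ?K q" if "q \<in> P" for a q
    unfolding kappa_name_def using that by (intro forces_mem_set_nameI small_image small_k) auto
  have B: "forces_mem P (bit_n b) ?B q" if "q \<in> P" for b q
    unfolding two_name_def using that by (intro forces_mem_set_nameI small_bits) auto
  have "forces P (FBall ?c (\<lambda>z. FBex ?K (\<lambda>x. FBex ?B (\<lambda>y. FEq z (pair_n x y))))) p"
  proof (rule forces_FBallI)
    fix z q assume "q \<in> P" "forces_mem P z ?c q"
    then obtain r a b p where r: "r \<in> P" "r \<le> q" "forces_eq P (pair_n (ord_n a) (bit_n b)) z r"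
      using forces_mem_decidedD by metis
    have "forces P (FBex ?K (\<lambda>x. FBex ?B (\<lambda>y. FEq z (pair_n x y)))) r"
      by (rule forces_FBexI[of "ord_n a"] forces_FBexI[of "bit_n b"] ord_name_in_names
          bit_name_in_names K B r(1))+ (simp add: forces_eq_sym[OF r(3)])
    then show "\<exists>r\<in>P. r \<le> q \<and> forces P (FBex ?K (\<lambda>x. FBex ?B (\<lambda>y. FEq z (pair_n x y)))) r"
      using r(1,2) by blast
  qed
  moreover have "forces P (FBall ?K (\<lambda>x. FBex ?B (\<lambda>y. FAnd (FMem (pair_n x y) ?c)
      (FBall ?B (\<lambda>y'. FImp (FMem (pair_n x y') ?c) (FEq y' y)))))) p"
  proof (rule forces_FBallI)
    fix x q assume q: "q \<in> P" "forces_mem P x ?K q"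
    obtain r a where r: "r \<in> P" "r \<le> q" and x: "forces_eq P (ord_n a) x r"
      using forces_mem_set_nameD[OF small_image[OF small_k] q(2)[unfolded kappa_name_def] q(1)]
      by blast
    obtain s b where s: "s \<in> P" "s \<le> r" "dec s a b"
      using total[OF r(1)] by blast
    have "forces_eq P (pair_n (ord_n a) (bit_n b)) (pair_n x (bit_n b)) s"
      by (rule forces_eq_pair_nameI[OF forces_eq_mono[OF x s(2)] forces_eq_refl])
    then have mem: "forces_mem P (pair_n x (bit_n b)) ?c s"
      by (rule forces_mem_decidedI[where dec = dec, OF s(1,3) order_refl])
    have "forces P (FBall ?B (\<lambda>y'. FImp (FMem (pair_n x y') ?c) (FEq y' (bit_n b)))) s"
    proof (rule forces_FBallI)
      fix y u assume u: "u \<in> P" "u \<le> s" "forces_mem P y ?B u"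
      obtain v b' where v: "v \<in> P" "v \<le> u" and y: "forces_eq P (bit_n b') y v"
        using forces_mem_set_nameD[OF small_bits u(3)[unfolded two_name_def] u(1)] by blast
      have "forces P (FImp (FMem (pair_n x y) ?c) (FEq y (bit_n b))) v"
      proof (rule forces_FImpI)
        fix w assume w: "w \<in> P" "w \<le> v" "forces P (FMem (pair_n x y) ?c) w"
        from w(3) have "forces_mem P (pair_n x y) ?c w"
          by simp
        then obtain t a2 b2 d where t: "t \<in> P" "t \<le> w" "d \<in> P" "t \<le> d" "dec d a2 b2"
          "forces_eq P (pair_n (ord_n a2) (bit_n b2)) (pair_n x y) t"
          using forces_mem_decidedD[OF _ w(1)] by metis
        have "t \<le> v" "t \<le> s" "t \<le> r"
          using t(2) w(2) v(2) u(2) s(2) by (meson order_trans)+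
        \<comment> \<open>\<open>x\<close> and \<open>y\<close> are arbitrary names; below
          \<open>t\<close> they are replaced by canonical ones, whose pairs can be compared.\<close>
        have "forces_eq P (pair_n x y) (pair_n (ord_n a) (bit_n b')) t"
          by (rule forces_eq_pair_nameI) (rule forces_eq_sym, rule forces_eq_mono,
              rule x y, rule \<open>t \<le> r\<close> \<open>t \<le> v\<close>)+
        then have "a2 = a \<and> b2 = b'"
          using forces_eq_pair_bit_nameD forces_eq_trans[OF t(6)] t(1) by blast
        \<comment> \<open>\<open>t\<close> extends both \<open>d\<close> and \<open>s\<close>, which
          decide bit \<open>a\<close> as \<open>b'\<close> and as \<open>b\<close>.\<close>
        then have "b' = b"
          using unique[OF t(3) s(1) t(1,4) \<open>t \<le> s\<close>] t(5) s(3) by blast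
        then have "forces P (FEq y (bit_n b)) w"
          using forces_eq_sym[OF forces_eq_mono[OF y w(2)]] by simp
        then show "\<exists>t\<in>P. t \<le> w \<and> forces P (FEq y (bit_n b)) t"
          using w(1) by blast
      qed
      then show "\<exists>v\<in>P. v \<le> u \<and> forces P (FImp (FMem (pair_n x y) ?c) (FEq y (bit_n b))) v"
        using v by blast
    qed
    with mem have "forces P (FBex ?B (\<lambda>y. FAnd (FMem (pair_n x y) ?c)
        (FBall ?B (\<lambda>y'. FImp (FMem (pair_n x y') ?c) (FEq y' y))))) s"
      by (intro forces_FBexI[of "bit_n b"] bit_name_in_names B s(1)) simp
    moreover have "s \<le> q"
      using s(2) r(2) by (rule order_trans)
    ultimately show "\<exists>s\<in>P. s \<le> q \<and> forces P (FBex ?B (\<lambda>y. FAnd (FMem (pair_n x y) ?c)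
        (FBall ?B (\<lambda>y'. FImp (FMem (pair_n x y') ?c) (FEq y' y))))) s"
      using s(1) by blast
  qed
  ultimately show ?thesis
    unfolding function_fm_def by simp
qed

text \<open>A name for a ground model dense set is forced by some extension to equal the canonical
  name of one \<open>D\<close>; a further extension decides all bits of some \<open>t\<close> in
  \<open>D\<close>.\<close>

lemma forces_meets_dense_sets:
  fixes dec :: "'p \<Rightarrow> 'k \<Rightarrow> bool \<Rightarrow> bool"
  assumes "\<And>p D. p \<in> P \<Longrightarrow> cohen_dense D \<Longrightarrow>
      \<exists>q\<in>P. q \<le> p \<and> (\<exists>t\<in>D. \<forall>a b. t a = Some b \<longrightarrow> dec q a b)"
  shows "forces P (FBall (dense_sets_name P TYPE('k))
      (\<lambda>D. FBex D (\<lambda>s. FSubset s (decided_name dec)))) p"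
proof (rule forces_FBallI)
  let ?c = "decided_name dec" and ?S = "\<lambda>D :: ('k \<rightharpoonup> bool) set. set_n (seq_name P ` D)"
  fix X :: "('i, 'p) name" and q
  assume q: "q \<in> P" "forces_mem P X (dense_sets_name P TYPE('k)) q"
  have "|Pow (kseqs :: ('k \<rightharpoonup> bool) set)| \<le>o |Pow (UNIV :: 'k set)|"
    using kseqs_small by (rule card_of_Pow_mono_ordLeq)
  then have "small k (Pow (kseqs :: ('k \<rightharpoonup> bool) set))"
    by (simp add: small_def)
  then have "small k {D :: ('k \<rightharpoonup> bool) set. cohen_dense D}"
    by (rule small_mono) (auto simp: cohen_dense_def)
  from forces_mem_set_nameD[OF small_image[OF this] q(2)[unfolded dense_sets_name_def] q(1)]
  obtain r D where r: "r \<in> P" "r \<le> q" and D: "cohen_dense D" "forces_eq P (?S D) X r"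
    by blast
  obtain s t where s: "s \<in> P" "s \<le> r" and t: "t \<in> D" "\<And>a b. t a = Some b \<Longrightarrow> dec s a b"
    using assms[OF r(1) D(1)] by blast
  have "small k D"
    using D(1) kseqs_small by (auto simp: cohen_dense_def intro: small_mono small_if_card_le_k)
  then have mem_D: "(seq_name P t, v) \<in> pairs (?S D)" if "v \<in> P" for v
    using t(1) that by (simp add: pairs_set_name[OF small_image])
  \<comment> \<open>\<open>X\<close> is not canonical, so membership is carried over from the
    canonical name of \<open>D\<close> along the forced equality.\<close>
  have "forces_mem P (seq_name P t) X s"
    unfolding forces_mem_def dense_below_def
  proof (intro ballI impI)
    fix u assume u: "u \<in> P" "u \<le> s"
    then have "forces_eq P (?S D) X u"
      using forces_eq_mono[OF D(2)] s(2) order_trans by blast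
    from forces_eq_pairsD[OF this mem_D[OF u(1)] u(1) order_refl]
    show "\<exists>v\<in>P. v \<le> u \<and> v \<in> {v. \<exists>(y, w)\<in>pairs X. v \<le> w \<and> forces_eq P y (seq_name P t) v}"
      using forces_eq_sym by fast
  qed
  moreover have "forces P (FSubset (seq_name P t) ?c) s"
    unfolding FSubset_def
  proof (rule forces_FBallI)
    fix z :: "('i, 'p) name" and u
    assume u: "u \<in> P" "u \<le> s" "forces_mem P z (seq_name P t) u"
    obtain v a b where v: "v \<in> P" "v \<le> u" "t a = Some b"
      "forces_eq P (pair_n (ord_n a) (bit_n b)) z v"
      using forces_mem_set_nameD[OF small_seq_graph u(3)[unfolded seq_name_def] u(1)] by blast
    have "forces_mem P z ?c v"
      using v(2) u(2) by (intro forces_mem_decidedI[where dec = dec, OF s(1) t(2)[OF v(3)] _ v(4)]) simp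
    then show "\<exists>v\<in>P. v \<le> u \<and> forces P (FMem z ?c) v"
      using v(1,2) by auto
  qed
  ultimately have "forces P (FBex X (\<lambda>s. FSubset s ?c)) s"
    by (intro forces_FBexI[of "seq_name P t"] seq_name_in_names)
  moreover have "s \<le> q"
    using s(2) r(2) by (rule order_trans)
  ultimately show "\<exists>r\<in>P. r \<le> q \<and> forces P (FBex X (\<lambda>s. FSubset s ?c)) r"
    using s(1) by blast
qed

text \<open>The work in the forcing language ends here; what remains is the combinatorics of
  \<open>dec\<close>.\<close>

lemma adds_cohen_realI:
  fixes dec :: "'p \<Rightarrow> 'k \<Rightarrow> bool \<Rightarrow> bool"
  assumes unique: "\<And>p q r a b b'. p \<in> P \<Longrightarrow> q \<in> P \<Longrightarrow> r \<in> P \<Longrightarrow> r \<le> p \<Longrightarrow> r \<le> q \<Longrightarrow>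
      dec p a b \<Longrightarrow> dec q a b' \<Longrightarrow> b = b'"
    and dense: "\<And>p D. p \<in> P \<Longrightarrow> cohen_dense D \<Longrightarrow>
      \<exists>q\<in>P. q \<le> p \<and> (\<exists>t\<in>D. \<forall>a b. t a = Some b \<longrightarrow> dec q a b)"
  shows "adds_cohen_real TYPE('i) TYPE('k) P"
proof -
  \<comment> \<open>Totality is density for the set of sequences that are defined at
    \<open>a\<close>.\<close>
  have total: "\<exists>q\<in>P. q \<le> p \<and> (\<exists>b. dec q a b)" if "p \<in> P" for p a
    using dense[OF that cohen_dense_dom[OF ex_above, of a]] by blast
  have "forces P (cohen_real_fm P TYPE('k) (decided_name dec)) p" for p
    using forces_function[of dec, OF unique total] forces_meets_dense_sets[of dec, OF dense]
    unfolding cohen_real_fm_def by simp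
  then show ?thesis
    unfolding adds_cohen_real_def forces.simps
    using decided_name_in_names by (blast intro: dense_belowI)
qed

end

section \<open>Trunks decide the generic sequence\<close>

lemma tree_up_idem: "tree_up (tree_up T \<sigma>) \<sigma> = tree_up T \<sigma>"
  by (auto simp: tree_up_def)

text \<open>\<open>T = tree_up T \<sigma>\<close> means that all nodes of \<open>T\<close> are
  comparable with \<open>\<sigma>\<close>. A node of \<open>S\<close> not below
  \<open>\<sigma>\<close> therefore extends \<open>\<sigma>\<close>; it is also comparable with
  \<open>\<sigma>'\<close>, and the longer of the two is a common extension.\<close>

lemma (in regular_uncountable) trunks_comparable:
  assumes "S \<in> (PL :: ('k \<rightharpoonup> 'k) set set)" "S \<subseteq> T" "S \<subseteq> T'" "T = tree_up T \<sigma>" "T' = tree_up T' \<sigma>'"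
  shows "\<exists>\<tau>. \<sigma> \<subseteq>\<^sub>m \<tau> \<and> \<sigma>' \<subseteq>\<^sub>m \<tau>"
proof -
  have comp: "\<sigma> \<subseteq>\<^sub>m \<tau> \<or> \<tau> \<subseteq>\<^sub>m \<sigma>" "\<sigma>' \<subseteq>\<^sub>m \<tau> \<or> \<tau> \<subseteq>\<^sub>m \<sigma>'" if "\<tau> \<in> S" for \<tau>
    using that assms(2-5) by (auto simp: tree_up_def)
  obtain \<tau> \<tau>' where "\<tau> \<in> S" "\<not> \<tau> \<subseteq>\<^sub>m \<sigma>" "\<tau>' \<in> S" "\<not> \<tau>' \<subseteq>\<^sub>m \<sigma>'"
    using PL_not_bounded[OF assms(1)] by meson
  then have "\<sigma> \<subseteq>\<^sub>m \<tau>" "\<sigma>' \<subseteq>\<^sub>m \<tau>'" "\<sigma>' \<subseteq>\<^sub>m \<tau> \<or> \<tau> \<subseteq>\<^sub>m \<sigma>'"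
    using comp by blast+
  then show ?thesis
    using map_le_trans map_le_refl by blast
qed

theorem theorem2:
  fixes P :: "('k::wellorder \<rightharpoonup> 'k) set set"
  assumes "Card_order (kappa :: 'k rel)"
    and "natLeq <o (kappa :: 'k rel)"
    and "regularCard (kappa :: 'k rel)"
    and "|kseqs :: ('k \<rightharpoonup> 'k) set| =o (kappa :: 'k rel)"
    and "P \<subseteq> PL"
    and "\<And>T \<sigma>. T \<in> P \<Longrightarrow> \<sigma> \<in> T \<Longrightarrow> tree_up T \<sigma> \<in> P"
    and "|UNIV :: 'k set set| \<le>o |UNIV :: 'i set|"
  shows "adds_cohen_real TYPE('i) TYPE('k) P"
proof -
  interpret regular_uncountable "TYPE('k)"
    by standard (fact assms(1-3))+
  have kseqs_k: "|kseqs :: ('k \<rightharpoonup> 'k) set| \<le>o |UNIV :: 'k set|"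
    using assms(4) card_UNIV ordIso_symmetric ordIso_transitive ordIso_iff_ordLeq by blast
  obtain z u :: 'k where "z \<noteq> u"
    using ex_greater by (metis less_irrefl)
  \<comment> \<open>Two points of \<kappa> encode the truth values, so binary sequences inject into
    sequences of ordinals.\<close>
  define e where "e = (\<lambda>b. if b then z else u)"
  have "inj e"
    using \<open>z \<noteq> u\<close> by (auto simp: e_def inj_def)
  then have "inj (\<lambda>s :: 'k \<rightharpoonup> bool. map_option e \<circ> s)"
    by (intro injI ext) (metis comp_apply injD option.inj_map)
  moreover have "map_option e \<circ> s \<in> kseqs" if "s \<in> kseqs" for s :: "'k \<rightharpoonup> bool"
    using that by (simp add: kseqs_def dom_map_option_comp)
  ultimately have "|kseqs :: ('k \<rightharpoonup> bool) set| \<le>o |kseqs :: ('k \<rightharpoonup> 'k) set|"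
    unfolding card_of_ordLeq[symmetric]
    by (intro exI[of _ "\<lambda>s. map_option e \<circ> s"]) (auto intro: inj_on_subset)
  then have kseqs_bool: "|kseqs :: ('k \<rightharpoonup> bool) set| \<le>o |UNIV :: 'k set|"
    using kseqs_k ordLeq_transitive by blast
  \<comment> \<open>Conditions are subsets of a set of size \<kappa>, which bounds their number by
    the number of subsets of \<kappa>.\<close>
  have "P \<subseteq> Pow kseqs"
    using assms(5) by (auto simp: PL_def is_tree_def)
  then have "|P| \<le>o |Pow (UNIV :: 'k set)|"
    using card_of_mono1 card_of_Pow_mono_ordLeq[OF kseqs_k] ordLeq_transitive by blast
  then interpret forcing_names P "TYPE('k)" "TYPE('i)"
    by unfold_locales (use ex_greater kseqs_bool assms(7) in \<open>simp_all add: small_def\<close>)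
  have "|kseqs :: ('k \<rightharpoonup> bool) set| \<le>o (kappa :: 'k rel)"
    using kseqs_bool card_UNIV ordLeq_ordIso_trans by blast
  moreover have "Map.empty \<in> (kseqs :: ('k \<rightharpoonup> bool) set)"
    by (rule kseqs_downward_closed[of _ z]) auto
  ultimately obtain col :: "'k \<Rightarrow> ('k \<rightharpoonup> bool)" where
    col: "\<And>\<delta>. col \<delta> \<in> kseqs" "\<And>t. t \<in> kseqs \<Longrightarrow> omega_stationary {\<delta>. col \<delta> = t}"
    using stationary_colouring[of kseqs] by (metis empty_iff)
  \<comment> \<open>A condition decides the bits decoded from those of its nodes that are comparable
    with all its nodes.\<close>
  define dec where "dec = (\<lambda>T a b. \<exists>\<sigma>\<in>T. T = tree_up T \<sigma> \<and> decode col \<sigma> a = Some b)"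
  show ?thesis
  proof (rule adds_cohen_realI[of dec])
    fix T T' S a b b'
    assume "S \<in> P" "S \<subseteq> T" "S \<subseteq> T'" "dec T a b" "dec T' a b'"
    then obtain \<sigma> \<sigma>' where \<sigma>: "T = tree_up T \<sigma>" "T' = tree_up T' \<sigma>'"
      "decode col \<sigma> a = Some b" "decode col \<sigma>' a = Some b'"
      by (auto simp: dec_def)
    obtain \<tau> where "\<sigma> \<subseteq>\<^sub>m \<tau>" "\<sigma>' \<subseteq>\<^sub>m \<tau>"
      using trunks_comparable[OF _ \<open>S \<subseteq> T\<close> \<open>S \<subseteq> T'\<close> \<sigma>(1,2)] \<open>S \<in> P\<close> assms(5) by blast
    then have "decode col \<tau> a = Some b" "decode col \<tau> a = Some b'"
      using \<sigma>(3,4) map_le_same[OF decode_mono] by (metis domI)+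
    then show "b = b'"
      by simp
  next
    fix T and D :: "('k \<rightharpoonup> bool) set"
    assume "T \<in> P" "cohen_dense D"
    then obtain \<sigma> t where \<sigma>: "\<sigma> \<in> T" and t: "t \<in> D" "t \<subseteq>\<^sub>m decode col \<sigma>"
      using decode_dense[OF col] assms(5) by blast
    \<comment> \<open>Passing to \<open>tree_up T \<sigma>\<close> puts \<open>\<sigma>\<close> on
      the trunk, so everything decoded from \<open>\<sigma>\<close> becomes decided.\<close>
    have "\<sigma> \<in> tree_up T \<sigma>"
      using \<sigma> by (simp add: tree_up_def)
    then have "\<forall>a b. t a = Some b \<longrightarrow> dec (tree_up T \<sigma>) a b"
      using map_le_same[OF t(2)] unfolding dec_def by (metis domI tree_up_idem)
    moreover have "tree_up T \<sigma> \<subseteq> T"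
      by (auto simp: tree_up_def)
    ultimately show "\<exists>S\<in>P. S \<subseteq> T \<and> (\<exists>t\<in>D. \<forall>a b. t a = Some b \<longrightarrow> dec S a b)"
      using assms(6)[OF \<open>T \<in> P\<close> \<sigma>] t(1) by blast
  qed
qed

end
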